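(* Let $p_a,p_b,p_c,p_d,p_e,p_f$ be nonnegative numbers summing to $1$ with $p_a+p_b>0$, put $q=p_a+p_b$, and let $(X_t)_{t\in\mathbb N}$ be a sequence of $\mathbb N$-valued random variables. Let $(G_t)_{t\ge0}$ be the growing undirected graph generated by the generalized Cooper--Frieze model with these parameters (defined in the context). Let $\ell=\ell(n)$ and $u=u(n)$ be positive integers such that $\ell\le X_t\le u$ for all $t$. Then asymptotically almost surely (as $n\to\infty$) the diameter of $G_n$ is at most $$4\left(\frac{u}{\ell}+\frac{11}{q}\right)e\log n+8e\,\frac{u}{\ell}+O(1).$$
   Context: Conventions: $\mathbb N=\{1,2,\dots\}$; $\log$ is the natural logarithm and $e$ its base. Graphs are finite and may have loops and parallel edges. The diameter is the maximum distance between two vertices. The initial graph $G_0$ has size $O(1)$. "Asymptotically almost surely" means with probability tending to $1$ as $n\to\infty$. For an undirected graph $G$, $\rho_0$ is the distribution on $V(G)$ given by $\rho_0(v)=\deg(v)/\sum_{w\in V(G)}\deg(w)$, where a loop is counted twice in the degree. Model: $G_0$ is an arbitrary connected graph. At each time-step $t\in\mathbb N$, exactly one of the following six operations is performed on the existing graph $G_{t-1}$ to obtain $G_t$, with probabilities $p_a,\dots,p_f$ respectively and independently of previous choices. (a) $X_t$ vertices are sampled uniformly, then a new vertex is born and is joined to the sampled vertices. (b) $X_t$ vertices are sampled using $\rho_0$, then a new vertex is born and is joined to the sampled vertices. (c) $X_t+1$ vertices are sampled uniformly. Then $X_t$ edges are added joining the first sampled vertex to the others. (d) A vertex is sampled uniformly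 and $X_t$ vertices are sampled using $\rho_0$. Then $X_t$ edges are added joining the first sampled vertex to the others. (e) A vertex is sampled using $\rho_0$ and $X_t$ vertices are sampled uniformly. Then $X_t$ edges are added joining the first sampled vertex to the others. (f) $X_t+1$ vertices are sampled using $\rho_0$. Then $X_t$ edges are added joining the first sampled vertex to the others. No independence is required for $(X_t)_{t\in\mathbb N}$. *)

theory Defs
  imports
    "HOL-Probability.Probability"
    "HOL-Library.Uprod"
    "HOL-Library.Extended_Nat"
begin

section \<open>Finite undirected multigraphs\<close>

text \<open>An edge is an unordered pair, a loop at \<open>v\<close> is \<open>Upair v v\<close>, and parallel edges
  are accounted for by multiplicity.  Vertices are labelled by natural numbers.\<close>

record multigraph =
  verts :: "nat set"
  edges :: "nat uprod multiset"

definition wf_multigraph :: "multigraph \<Rightarrow> bool" where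
  "wf_multigraph G \<longleftrightarrow>
     finite (verts G) \<and> verts G \<noteq> {} \<and> (\<forall>e\<in>#edges G. set_uprod e \<subseteq> verts G)"

definition adj :: "multigraph \<Rightarrow> nat \<Rightarrow> nat \<Rightarrow> bool" where
  "adj G v w \<longleftrightarrow> Upair v w \<in># edges G"

text \<open>Distance is the least length of a walk, and \<open>\<infinity>\<close> (the infimum of the
  empty set) if there is none.\<close>

definition distance :: "multigraph \<Rightarrow> nat \<Rightarrow> nat \<Rightarrow> enat" where
  "distance G v w = (INF k\<in>{k. (adj G ^^ k) v w}. enat k)"

definition graph_diameter :: "multigraph \<Rightarrow> enat" where
  "graph_diameter G = (SUP v\<in>verts G. SUP w\<in>verts G. distance G v w)"

definition connected_multigraph :: "multigraph \<Rightarrow> bool" where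
  "connected_multigraph G \<longleftrightarrow>
     wf_multigraph G \<and> (\<forall>v\<in>verts G. \<forall>w\<in>verts G. (adj G)\<^sup>*\<^sup>* v w)"

text \<open>The second summand makes every loop count twice.\<close>

definition deg :: "multigraph \<Rightarrow> nat \<Rightarrow> nat" where
  "deg G v = size {#e \<in># edges G. v \<in> set_uprod e#} + count (edges G) (Upair v v)"

section \<open>Sampling\<close>

definition uniform_vertex :: "multigraph \<Rightarrow> nat pmf" where
  "uniform_vertex G = pmf_of_set (verts G)"

text \<open>If there are no edges, the defining quotient is \<open>0/0\<close>.  A connected graph without edges
  is a single vertex, which carries only one probability distribution; the first branch
  below selects that one.\<close>

definition rho0 :: "multigraph \<Rightarrow> nat pmf" where
  "rho0 G =
     (if edges G = {#} then pmf_of_set (verts G)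
      else embed_pmf (\<lambda>v. if v \<in> verts G
                           then real (deg G v) / real (\<Sum>w\<in>verts G. deg G w) else 0))"

lemma pmf_rho0:
  assumes "wf_multigraph G" "edges G \<noteq> {#}" "v \<in> verts G"
  shows "pmf (rho0 G) v = real (deg G v) / real (\<Sum>w\<in>verts G. deg G w)"
proof -
  let ?S = "\<Sum>w\<in>verts G. deg G w"
  let ?f = "\<lambda>v. if v \<in> verts G then real (deg G v) / real ?S else 0"
  have fin: "finite (verts G)" using assms(1) by (simp add: wf_multigraph_def)
  obtain e where e: "e \<in># edges G" using assms(2) by (meson multiset_nonemptyE)
  obtain a b where ab: "e = Upair a b" by (cases e) auto
  have a: "a \<in> verts G" using assms(1) e ab by (auto simp: wf_multigraph_def)
  have "e \<in># {#e \<in># edges G. a \<in> set_uprod e#}" using e ab by simp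
  hence "size {#e \<in># edges G. a \<in> set_uprod e#} > 0"
    by (metis empty_iff nonempty_has_size set_mset_empty)
  hence "deg G a > 0" by (simp add: deg_def)
  hence S: "?S > 0" using a fin by (metis gr0I sum_eq_0_iff)
  have "(\<integral>\<^sup>+ v. ennreal (?f v) \<partial>count_space UNIV) = (\<Sum>v\<in>verts G. ennreal (?f v))"
    by (rule nn_integral_count_space'[OF fin]) auto
  also have "\<dots> = ennreal (\<Sum>v\<in>verts G. real (deg G v) / real ?S)"
    by (subst sum_ennreal[symmetric]) (auto intro!: sum.cong divide_nonneg_nonneg sum_nonneg)
  also have "(\<Sum>v\<in>verts G. real (deg G v) / real ?S) = 1"
    using S by (simp add: sum_divide_distrib[symmetric] del: of_nat_sum)
       (simp add: of_nat_sum[symmetric] del: of_nat_sum)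
  finally have "pmf (embed_pmf ?f) v = ?f v"
    by (intro pmf_embed_pmf) (auto intro!: divide_nonneg_nonneg sum_nonneg)
  thus ?thesis using assms by (simp add: rho0_def)
qed

section \<open>The generalized Cooper--Frieze model\<close>

definition add_vertex :: "multigraph \<Rightarrow> nat list \<Rightarrow> multigraph" where
  "add_vertex G vs =
     (let v = Suc (Max (verts G))
      in \<lparr>verts = insert v (verts G), edges = edges G + mset (map (Upair v) vs)\<rparr>)"

definition add_edges :: "multigraph \<Rightarrow> nat \<Rightarrow> nat list \<Rightarrow> multigraph" where
  "add_edges G v vs = G\<lparr>edges := edges G + mset (map (Upair v) vs)\<rparr>"

datatype cf_op = Op_a | Op_b | Op_c | Op_d | Op_e | Op_f

text \<open>Distribution of the next graph when the operation and the number \<open>x\<close> are given.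
  All samples are drawn independently, with replacement, from the existing graph.\<close>

primrec cf_op_step :: "cf_op \<Rightarrow> multigraph \<Rightarrow> nat \<Rightarrow> multigraph pmf" where
  "cf_op_step Op_a G x =
     map_pmf (add_vertex G) (replicate_pmf x (uniform_vertex G))"
| "cf_op_step Op_b G x =
     map_pmf (add_vertex G) (replicate_pmf x (rho0 G))"
| "cf_op_step Op_c G x =
     map_pmf (\<lambda>vs. add_edges G (hd vs) (tl vs)) (replicate_pmf (Suc x) (uniform_vertex G))"
| "cf_op_step Op_d G x =
     map_pmf (\<lambda>(v, vs). add_edges G v vs)
       (pair_pmf (uniform_vertex G) (replicate_pmf x (rho0 G)))"
| "cf_op_step Op_e G x =
     map_pmf (\<lambda>(v, vs). add_edges G v vs)
       (pair_pmf (rho0 G) (replicate_pmf x (uniform_vertex G)))"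
| "cf_op_step Op_f G x =
     map_pmf (\<lambda>vs. add_edges G (hd vs) (tl vs)) (replicate_pmf (Suc x) (rho0 G))"

definition cf_step :: "(cf_op \<Rightarrow> real) \<Rightarrow> multigraph \<Rightarrow> nat \<Rightarrow> multigraph pmf" where
  "cf_step p G x = bind_pmf (embed_pmf p) (\<lambda>i. cf_op_step i G x)"

text \<open>\<open>F t\<close> is the information available just before step \<open>t + 1\<close> is carried out; it
  contains \<open>G 0, \<dots>, G t\<close> and \<open>X 1, \<dots>, X (t + 1)\<close>, and given it the operation and the samples of
  that step are fresh.  The joint law of the \<open>X t\<close> is arbitrary.  A sequence \<open>X\<close> given
  in advance is the case in which the whole of \<open>X\<close> is measurable with respect to \<open>F 0\<close>.\<close>

locale cooper_frieze = prob_space M + filtration "space M" F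
  for M :: "'w measure" and F :: "nat \<Rightarrow> 'w measure" +
  fixes p :: "cf_op \<Rightarrow> real"
    and G0 :: multigraph
    and X :: "nat \<Rightarrow> 'w \<Rightarrow> nat"
    and G :: "nat \<Rightarrow> 'w \<Rightarrow> multigraph"
  assumes subalgebra_F: "\<And>t. subalgebra M (F t)"
    and connected_G0: "connected_multigraph G0"
    and measurable_X: "\<And>t. X (Suc t) \<in> measurable (F t) (count_space {1..})"
    and measurable_G: "\<And>t. G t \<in> measurable (F t) (count_space UNIV)"
    and G_0: "\<And>\<omega>. \<omega> \<in> space M \<Longrightarrow> G 0 \<omega> = G0"
    and G_Suc: "\<And>t H. AE \<omega> in M.
          real_cond_exp M (F t) (indicat_real {\<omega> \<in> space M. G (Suc t) \<omega> = H}) \<omega>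
            = pmf (cf_step p (G t \<omega>) (X (Suc t) \<omega>)) H"

end

theory Submission
  imports Defs
begin

text \<open>Fix a root in \<open>G 0\<close> and let \<open>d\<close> be the distance from it in the current graph.  Then \<open>d\<close> never
  increases when edges are added, and a new vertex has depth at most one more than the first
  vertex it is joined to.  Consider \<open>\<Phi> = (\<Sum>v. exp (d v))\<close> and \<open>\<Psi> = (\<Sum>v. deg v * exp (d v))\<close>.  A uniform
  sample has expected weight \<open>\<Phi> / |V|\<close> and a degree-biased one \<open>\<Psi> / (2 |E|)\<close>, so one step changes
  \<open>\<Phi> + (q/u) \<Psi>\<close>, in conditional expectation, by at most \<open>7 q (\<Phi> / |V| + \<Psi> / (2 |E|))\<close>.  The first part
  is compensated by a factor of order \<open>|V| powr -7\<close>, which drops with every birth, hence with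
  probability \<open>q\<close>; since \<open>|E| \<ge> l t\<close>, the second part is compensated by a factor of order
  \<open>t powr (-7u/(2l))\<close>.  The resulting supermartingale needs no concentration of \<open>|V|\<close>, and Markov's inequality
  bounds the height of the graph, of which the diameter is at most twice.\<close>

section \<open>Depth and the weights of vertices and degrees\<close>

lemma deg_add_mset:
  "deg \<lparr>verts = V, edges = add_mset (Upair a b) E\<rparr> y =
     deg \<lparr>verts = V', edges = E\<rparr> y + of_bool (y = a) + of_bool (y = b)"
  by (auto simp: deg_def)

text \<open>An edge contributes \<open>f\<close> at both ends; for a loop the second summand of
  \<open>deg\<close> supplies the second contribution. The constant \<open>f = 1\<close> yields the
  handshake identity below.\<close>

lemma sum_deg_add_mset:
  fixes f :: "nat \<Rightarrow> real"
  assumes "finite V" "a \<in> V" "b \<in> V"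
  shows "(\<Sum>y\<in>V. real (deg \<lparr>verts = V, edges = add_mset (Upair a b) E\<rparr> y) * f y) =
         (\<Sum>y\<in>V. real (deg \<lparr>verts = V, edges = E\<rparr> y) * f y) + f a + f b"
proof -
  have "real (deg \<lparr>verts = V, edges = add_mset (Upair a b) E\<rparr> y) * f y =
        real (deg \<lparr>verts = V, edges = E\<rparr> y) * f y + (if y = a then f y else 0) + (if y = b then f y else 0)" for y
    by (simp add: deg_add_mset[where V' = V] algebra_simps)
  thus ?thesis
    using assms by (simp add: sum.distrib)
qed

lemma sum_deg_multigraph:
  assumes "finite V" "\<forall>e\<in>#E. set_uprod e \<subseteq> V"
  shows "(\<Sum>y\<in>V. real (deg \<lparr>verts = V, edges = E\<rparr> y)) = 2 * real (size E)"
  using assms(2)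
proof (induction E)
  case empty
  show ?case by (simp add: deg_def)
next
  case (add e E)
  obtain a b where ab: "e = Upair a b" by (cases e) auto
  show ?case
    using sum_deg_add_mset[OF assms(1), of a b E "\<lambda>_. 1"] add ab by simp
qed

lemma sum_deg_add_edges:
  fixes f :: "nat \<Rightarrow> real"
  assumes "finite V" "v \<in> V" "set vs \<subseteq> V"
  shows "(\<Sum>y\<in>V. real (deg \<lparr>verts = V, edges = E + mset (map (Upair v) vs)\<rparr> y) * f y) =
         (\<Sum>y\<in>V. real (deg \<lparr>verts = V, edges = E\<rparr> y) * f y) +
         real (length vs) * f v + (\<Sum>w\<leftarrow>vs. f w)"
  using assms(3)
proof (induction vs)
  case (Cons w vs)
  thus ?case
    using sum_deg_add_mset[OF assms(1,2), of w "E + mset (map (Upair v) vs)" f]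
    by (simp add: algebra_simps)
qed simp

text \<open>Moves between arbitrary graphs and the explicit records of the degree sums, including
  records with an enlarged vertex set.\<close>

lemma deg_cong: "edges G = edges H \<Longrightarrow> deg G = deg H"
  by (simp add: deg_def fun_eq_iff)


section \<open>Walks, depth below a root, and the diameter\<close>

lemma adj_sym: "adj G v w \<Longrightarrow> adj G w v"
  by (simp add: adj_def) (metis Upair_inject)

lemma relpowp_sym:
  assumes "\<And>x y. R x y \<Longrightarrow> R y x" "(R ^^ k) x y"
  shows "(R ^^ k) y x"
  using assms(2)
proof (induction k arbitrary: y)
  case (Suc k)
  then obtain z where "(R ^^ k) x z" "R z y" by auto
  thus ?case using Suc.IH assms(1) by (metis relpowp_Suc_I2)
qed auto

text \<open>A natural number, unlike \<open>distance\<close>, so that it can stand in an exponent;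
  \<open>rooted\<close> guarantees that the minimum is over a nonempty set.\<close>

definition depth :: "nat \<Rightarrow> multigraph \<Rightarrow> nat \<Rightarrow> nat" where
  "depth r G v = (LEAST k. (adj G ^^ k) r v)"

definition rooted :: "nat \<Rightarrow> multigraph \<Rightarrow> bool" where
  "rooted r G \<longleftrightarrow> wf_multigraph G \<and> r \<in> verts G \<and> (\<forall>v\<in>verts G. \<exists>k. (adj G ^^ k) r v)"

lemma relpowp_depth:
  assumes "rooted r G" "v \<in> verts G"
  shows "(adj G ^^ depth r G v) r v"
  using assms unfolding depth_def rooted_def by (meson LeastI)

lemma depth_le: "(adj G ^^ k) r v \<Longrightarrow> depth r G v \<le> k"
  by (simp add: depth_def Least_le)

text \<open>The walk goes from \<open>v\<close> back to the root, by symmetry of \<open>adj\<close>,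
  and then out to \<open>w\<close>.\<close>

lemma distance_le_depth:
  assumes "rooted r G" "v \<in> verts G" "w \<in> verts G"
  shows "distance G v w \<le> enat (depth r G v + depth r G w)"
proof -
  have "(adj G ^^ (depth r G v + depth r G w)) v w"
    using relpowp_trans[OF relpowp_sym[OF adj_sym relpowp_depth[OF assms(1,2)]]
        relpowp_depth[OF assms(1,3)]] by simp
  thus ?thesis unfolding distance_def by (auto intro: INF_lower)
qed

lemma graph_diameter_le:
  assumes "rooted r G" "\<And>v. v \<in> verts G \<Longrightarrow> real (depth r G v) \<le> k"
  shows "ereal_of_enat (graph_diameter G) \<le> ereal (2 * k)"
proof -
  have fin: "finite (verts G)" "verts G \<noteq> {}"
    using assms(1) by (auto simp: rooted_def wf_multigraph_def)
  \<comment> \<open>The bound \<open>k\<close> is real and the diameter an \<open>enat\<close>, so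
    the estimate passes through the integer height \<open>D\<close>.\<close>
  define D where "D = Max (depth r G ` verts G)"
  have D: "depth r G v \<le> D" if "v \<in> verts G" for v
    using that fin by (simp add: D_def)
  have "D \<in> depth r G ` verts G"
    unfolding D_def using fin by (intro Max_in) auto
  hence "real D \<le> k" using assms(2) by auto
  have "distance G v w \<le> enat (2 * D)" if "v \<in> verts G" "w \<in> verts G" for v w
    using distance_le_depth[OF assms(1) that] D[OF that(1)] D[OF that(2)]
    by (elim order_trans) simp
  hence "graph_diameter G \<le> enat (2 * D)"
    unfolding graph_diameter_def by (intro SUP_least)
  hence "ereal_of_enat (graph_diameter G) \<le> ereal_of_enat (enat (2 * D))"
    by (simp only: ereal_of_enat_le_iff)
  also have "\<dots> \<le> ereal (2 * k)" using \<open>real D \<le> k\<close> by simp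
  finally show ?thesis .
qed

lemma depth_antimono:
  assumes "rooted r G" "v \<in> verts G" "edges G \<subseteq># edges H"
  shows "depth r H v \<le> depth r G v"
proof (rule depth_le)
  show "(adj H ^^ depth r G v) r v"
    by (rule relpowp_mono[OF _ relpowp_depth[OF assms(1,2)]])
       (use assms(3) in \<open>auto simp: adj_def dest: mset_subset_eqD\<close>)
qed

section \<open>Exponential depth weights and their change under the two kinds of update\<close>

text \<open>This and \<open>degree_weight\<close> are the \<Phi> and \<Psi> of the overview. Up to
  normalization they are the mean values of \<open>exp (depth)\<close> under uniform and
  degree-biased sampling.\<close>

definition vertex_weight :: "nat \<Rightarrow> multigraph \<Rightarrow> real" where
  "vertex_weight r G = (\<Sum>v\<in>verts G. exp (real (depth r G v)))"

definition degree_weight :: "nat \<Rightarrow> multigraph \<Rightarrow> real" where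
  "degree_weight r G = (\<Sum>v\<in>verts G. real (deg G v) * exp (real (depth r G v)))"

text \<open>Old depths can only drop, so old weights bound the new ones. What remains is the degree
  identity: the common end \<open>v\<close> is counted once per new edge, every other end once per
  occurrence in the list.\<close>

lemma rooted_add_edges:
  fixes r G
  defines "f \<equiv> \<lambda>v. exp (real (depth r G v))"
  assumes G: "rooted r G" and v: "v \<in> verts G" and vs: "set vs \<subseteq> verts G"
  defines "H \<equiv> add_edges G v vs"
  shows "verts H = verts G" "size (edges H) = size (edges G) + length vs" "rooted r H"
    "\<And>y. y \<in> verts G \<Longrightarrow> depth r H y \<le> depth r G y"
    "vertex_weight r H \<le> vertex_weight r G" "degree_weight r H \<le> degree_weight r G + real (length vs) * f v + (\<Sum>w\<leftarrow>vs. f w)"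
proof -
  show V: "verts H = verts G" and "size (edges H) = size (edges G) + length vs"
    by (simp_all add: H_def add_edges_def)
  have fin: "finite (verts G)" using G by (simp add: rooted_def wf_multigraph_def)
  have sub: "edges G \<subseteq># edges H" by (simp add: H_def add_edges_def)
  show d: "depth r H y \<le> depth r G y" if "y \<in> verts G" for y
    by (rule depth_antimono[OF G that sub])
  have wf: "wf_multigraph H"
    using G v vs by (auto simp: H_def add_edges_def rooted_def wf_multigraph_def)
  have "\<exists>k. (adj H ^^ k) r y" if "y \<in> verts H" for y
  proof -
    have "(adj H ^^ depth r G y) r y"
      by (rule relpowp_mono[OF _ relpowp_depth[OF G]])
         (use that V sub in \<open>auto simp: adj_def dest: mset_subset_eqD\<close>)
    thus ?thesis by blast
  qed
  thus "rooted r H" using wf G V by (auto simp: rooted_def)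
  show "vertex_weight r H \<le> vertex_weight r G" unfolding vertex_weight_def V by (intro sum_mono) (simp add: d)
  have "degree_weight r H \<le> (\<Sum>y\<in>verts G. real (deg H y) * f y)"
    unfolding degree_weight_def V f_def by (intro sum_mono mult_left_mono) (simp_all add: d)
  also have "\<dots> = (\<Sum>y\<in>verts G. real (deg \<lparr>verts = verts G, edges = edges G + mset (map (Upair v) vs)\<rparr> y) * f y)"
    by (intro sum.cong arg_cong2[where f="(*)"] arg_cong[where f=real] fun_cong[OF deg_cong])
       (simp_all add: H_def add_edges_def)
  also have "\<dots> = (\<Sum>y\<in>verts G. real (deg \<lparr>verts = verts G, edges = edges G\<rparr> y) * f y)
      + real (length vs) * f v + (\<Sum>w\<leftarrow>vs. f w)"
    by (rule sum_deg_add_edges[OF fin v vs])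
  also have "(\<Sum>y\<in>verts G. real (deg \<lparr>verts = verts G, edges = edges G\<rparr> y) * f y) = degree_weight r G"
    unfolding degree_weight_def f_def
    by (intro sum.cong arg_cong2[where f="(*)"] arg_cong[where f=real] fun_cong[OF deg_cong]) simp_all
  finally show "degree_weight r H \<le> degree_weight r G + real (length vs) * f v + (\<Sum>w\<leftarrow>vs. f w)" .
qed

text \<open>The depth of the new vertex is bounded through the first sampled vertex alone. This
  loses something when several are sampled, but the expectation of a function of a single sample is
  explicit. A birth raises the height by at most one, whence the fourth claim.\<close>

lemma rooted_add_vertex:
  fixes r G
  defines "f \<equiv> \<lambda>v. exp (real (depth r G v))"
  assumes G: "rooted r G" and vs: "set vs \<subseteq> verts G" "vs \<noteq> []"
  defines "H \<equiv> add_vertex G vs"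
  shows "card (verts H) = Suc (card (verts G))"
    "size (edges H) = size (edges G) + length vs" "rooted r H"
    "(\<And>y. y \<in> verts G \<Longrightarrow> depth r G y \<le> D) \<Longrightarrow> \<forall>y\<in>verts H. depth r H y \<le> Suc D"
    "vertex_weight r H \<le> vertex_weight r G + exp 1 * f (hd vs)"
    "degree_weight r H \<le> degree_weight r G + real (length vs) * (exp 1 * f (hd vs)) + (\<Sum>w\<leftarrow>vs. f w)"
proof -
  define a where "a = Suc (Max (verts G))"
  have V: "verts H = insert a (verts G)" and E: "edges H = edges G + mset (map (Upair a) vs)"
    by (simp_all add: H_def add_vertex_def a_def Let_def)
  have fin: "finite (verts G)" using G by (simp add: rooted_def wf_multigraph_def)
  have a: "a \<notin> verts G"
    using Max_ge[OF fin, of a] by (auto simp: a_def)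
  show "card (verts H) = Suc (card (verts G))" using a fin by (simp add: V)
  show "size (edges H) = size (edges G) + length vs" by (simp add: E)
  have sub: "edges G \<subseteq># edges H" by (simp add: E)
  have d: "depth r H y \<le> depth r G y" if "y \<in> verts G" for y
    by (rule depth_antimono[OF G that sub])
  have wf: "wf_multigraph H"
    using G vs by (auto simp: E V rooted_def wf_multigraph_def)
  have old: "(adj H ^^ depth r G y) r y" if "y \<in> verts G" for y
    by (rule relpowp_mono[OF _ relpowp_depth[OF G]])
       (use that sub in \<open>auto simp: adj_def dest: mset_subset_eqD\<close>)
  have hd: "hd vs \<in> verts G" using vs by auto
  have "Upair a (hd vs) \<in># edges H" using vs by (auto simp: E)
  hence "adj H (hd vs) a" by (metis adj_def adj_sym)
  hence new: "(adj H ^^ Suc (depth r G (hd vs))) r a"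
    using old[OF hd] by (metis relpowp_Suc_I)
  have da: "depth r H a \<le> Suc (depth r G (hd vs))" by (rule depth_le[OF new])
  have "\<exists>k. (adj H ^^ k) r y" if "y \<in> verts H" for y
    using that old new by (metis V insert_iff)
  thus "rooted r H" using wf G V unfolding rooted_def by blast
  show "\<forall>y\<in>verts H. depth r H y \<le> Suc D" if "\<And>y. y \<in> verts G \<Longrightarrow> depth r G y \<le> D"
    using that d da hd by (fastforce simp: V)
  \<comment> \<open>\<open>g\<close> extends \<open>f\<close> to the new vertex by its upper bound.
    Replacing the true weights by \<open>g\<close> fixes the summands, and the degree identity
    applies.\<close>
  define g where "g = f(a := exp 1 * f (hd vs))"
  have g: "exp (real (depth r H y)) \<le> g y" if "y \<in> verts H" for y
    using that d da a by (auto simp: V g_def f_def simp flip: exp_add)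
  have "vertex_weight r H \<le> (\<Sum>y\<in>verts H. g y)" unfolding vertex_weight_def by (intro sum_mono g)
  also have "\<dots> = exp 1 * f (hd vs) + (\<Sum>y\<in>verts G. f y)"
    using a fin by (auto simp: V g_def intro!: sum.cong)
  finally show "vertex_weight r H \<le> vertex_weight r G + exp 1 * f (hd vs)" by (simp add: vertex_weight_def f_def)
  have "degree_weight r H \<le> (\<Sum>y\<in>verts H. real (deg H y) * g y)"
    unfolding degree_weight_def by (intro sum_mono mult_left_mono g) simp_all
  also have "\<dots> = (\<Sum>y\<in>verts H. real (deg \<lparr>verts = verts H, edges = edges G + mset (map (Upair a) vs)\<rparr> y) * g y)"
    by (intro sum.cong arg_cong2[where f="(*)"] arg_cong[where f=real] fun_cong[OF deg_cong])
       (simp_all add: E)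
  also have "\<dots> = (\<Sum>y\<in>verts H. real (deg \<lparr>verts = verts H, edges = edges G\<rparr> y) * g y)
      + real (length vs) * g a + (\<Sum>w\<leftarrow>vs. g w)"
    by (rule sum_deg_add_edges) (use fin vs in \<open>auto simp: V\<close>)
  also have "(\<Sum>y\<in>verts H. real (deg \<lparr>verts = verts H, edges = edges G\<rparr> y) * g y) =
      real (deg G a) * g a + (\<Sum>y\<in>verts G. real (deg G y) * g y)"
    using a fin by (simp add: V deg_cong[of "\<lparr>verts = insert a (verts G), edges = edges G\<rparr>" G])
  \<comment> \<open>The new label lies outside \<open>verts G\<close>, so no old edge meets
    it.\<close>
  also have "deg G a = 0"
  proof -
    have "a \<notin> set_uprod e" if "e \<in># edges G" for e
      using G a that by (auto simp: rooted_def wf_multigraph_def)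
    thus ?thesis by (force simp: deg_def count_eq_zero_iff)
  qed
  also have "(\<Sum>y\<in>verts G. real (deg G y) * g y) = degree_weight r G"
    using a unfolding degree_weight_def f_def g_def by (auto intro!: sum.cong)
  also have "(\<Sum>w\<leftarrow>vs. g w) = (\<Sum>w\<leftarrow>vs. f w)"
    using vs a by (auto simp: g_def intro!: arg_cong[where f=sum_list])
  finally show "degree_weight r H \<le> degree_weight r G + real (length vs) * (exp 1 * f (hd vs)) + (\<Sum>w\<leftarrow>vs. f w)"
    by (simp add: g_def)
qed

section \<open>Sampling and one step of the model\<close>

lemma sum_deg:
  assumes "wf_multigraph G"
  shows "(\<Sum>v\<in>verts G. real (deg G v)) = 2 * real (size (edges G))"
proof -
  have "(\<Sum>y\<in>verts G. real (deg \<lparr>verts = verts G, edges = edges G\<rparr> y)) = 2 * real (size (edges G))"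
    using assms by (intro sum_deg_multigraph) (auto simp: wf_multigraph_def)
  thus ?thesis using deg_cong[of "\<lparr>verts = verts G, edges = edges G\<rparr>" G] by simp
qed

lemma set_pmf_uniform_vertex:
  "wf_multigraph G \<Longrightarrow> set_pmf (uniform_vertex G) = verts G"
  by (simp add: uniform_vertex_def wf_multigraph_def)

text \<open>By the handshake identity the degree quotients over \<open>verts G\<close> already add
  up to 1, so no mass is left elsewhere.\<close>

lemma set_pmf_rho0:
  assumes "wf_multigraph G"
  shows "set_pmf (rho0 G) \<subseteq> verts G"
proof (cases "edges G = {#}")
  case True
  thus ?thesis using assms by (simp add: rho0_def wf_multigraph_def)
next
  case False
  have "measure (rho0 G) (verts G) = (\<Sum>v\<in>verts G. pmf (rho0 G) v)"
    using assms by (intro measure_measure_pmf_finite) (simp add: wf_multigraph_def)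
  also have "\<dots> = (\<Sum>v\<in>verts G. real (deg G v)) / real (\<Sum>w\<in>verts G. deg G w)"
    unfolding sum_divide_distrib using assms False by (intro sum.cong) (simp_all add: pmf_rho0)
  also have "\<dots> = 1"
    unfolding of_nat_sum sum_deg[OF assms] using False by simp
  finally show ?thesis
    using measure_pmf.AE_prob_1[of "rho0 G" "verts G"] by (auto simp: AE_measure_pmf_iff)
qed

lemma expectation_uniform_vertex:
  assumes "wf_multigraph G"
  shows "measure_pmf.expectation (uniform_vertex G) f = (\<Sum>v\<in>verts G. f v :: real) / real (card (verts G))"
  using assms by (simp add: uniform_vertex_def wf_multigraph_def integral_pmf_of_set)

lemma expectation_rho0:
  assumes "wf_multigraph G" "edges G \<noteq> {#}"
  shows "measure_pmf.expectation (rho0 G) f =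
           (\<Sum>v\<in>verts G. real (deg G v) * f v) / (2 * real (size (edges G)))"
proof -
  have "measure_pmf.expectation (rho0 G) f = (\<Sum>v\<in>verts G. f v * pmf (rho0 G) v)"
    using assms set_pmf_rho0[OF assms(1)]
    by (intro integral_measure_pmf_real) (auto simp: wf_multigraph_def)
  also have "\<dots> = (\<Sum>v\<in>verts G. real (deg G v) * f v) / real (\<Sum>w\<in>verts G. deg G w)"
    using assms by (simp add: pmf_rho0 sum_divide_distrib mult.commute)
  finally show ?thesis using sum_deg[OF assms(1)] by simp
qed

lemma finite_set_replicate_pmf:
  "finite (set_pmf P) \<Longrightarrow> finite (set_pmf (replicate_pmf n P))"
  using finite_lists_length_eq[of "set_pmf P" n]
  by (simp add: set_replicate_pmf lists_eq_set)

lemma map_hd_replicate_pmf: "map_pmf hd (replicate_pmf (Suc n) P) = P"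
  by (simp add: map_bind_pmf bind_return_pmf')

lemma map_tl_replicate_pmf: "map_pmf tl (replicate_pmf (Suc n) P) = replicate_pmf n P"
  by (simp add: map_bind_pmf bind_return_pmf')

lemma expectation_hd_replicate_pmf:
  fixes f :: "'a \<Rightarrow> real"
  shows "measure_pmf.expectation (replicate_pmf (Suc n) P) (\<lambda>vs. f (hd vs)) = measure_pmf.expectation P f"
  using integral_map_pmf[of hd "replicate_pmf (Suc n) P" f] by (simp only: map_hd_replicate_pmf)

text \<open>Linearity of expectation: every entry of the list has law \<open>P\<close>. Finite
  support makes all functions integrable.\<close>

lemma expectation_sum_list_replicate_pmf:
  fixes f :: "'a \<Rightarrow> real"
  assumes "finite (set_pmf P)"
  shows "measure_pmf.expectation (replicate_pmf n P) (\<lambda>vs. \<Sum>w\<leftarrow>vs. f w) =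
           real n * measure_pmf.expectation P f"
proof (induction n)
  case (Suc n)
  have fin: "finite (set_pmf (replicate_pmf m P))" for m
    by (rule finite_set_replicate_pmf[OF assms])
  have "measure_pmf.expectation (replicate_pmf (Suc n) P) (\<lambda>vs. \<Sum>w\<leftarrow>vs. f w) =
        measure_pmf.expectation (replicate_pmf (Suc n) P) (\<lambda>vs. f (hd vs) + (\<Sum>w\<leftarrow>tl vs. f w))"
  proof (intro integral_cong_AE)
    \<comment> \<open>Splitting into \<open>hd\<close> and \<open>tl\<close> is valid for nonempty
      lists only, hence almost everywhere and not pointwise.\<close>
    show "AE vs in replicate_pmf (Suc n) P. (\<Sum>w\<leftarrow>vs. f w) = f (hd vs) + (\<Sum>w\<leftarrow>tl vs. f w)"
      unfolding AE_measure_pmf_iff set_replicate_pmf by (auto simp: length_Suc_conv)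
  qed simp_all
  also have "\<dots> = measure_pmf.expectation P f +
      measure_pmf.expectation (replicate_pmf (Suc n) P) (\<lambda>vs. \<Sum>w\<leftarrow>tl vs. f w)"
    by (subst Bochner_Integration.integral_add)
       (simp_all only: expectation_hd_replicate_pmf integrable_measure_pmf_finite fin)
  also have "measure_pmf.expectation (replicate_pmf (Suc n) P) (\<lambda>vs. \<Sum>w\<leftarrow>tl vs. f w) =
      measure_pmf.expectation (replicate_pmf n P) (\<lambda>vs. \<Sum>w\<leftarrow>vs. f w)"
    using integral_map_pmf[of tl "replicate_pmf (Suc n) P" "\<lambda>vs. \<Sum>w\<leftarrow>vs. f w"]
    by (simp only: map_tl_replicate_pmf)
  finally show ?case by (simp add: Suc.IH algebra_simps)
qed simp

lemma expectation_le_pmf: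
  fixes f :: "'a \<Rightarrow> real"
  assumes "finite (set_pmf P)" "\<And>x. x \<in> set_pmf P \<Longrightarrow> f x \<le> g x"
  shows "measure_pmf.expectation P f \<le> measure_pmf.expectation P g"
  by (intro integral_mono_AE integrable_measure_pmf_finite assms(1))
     (use assms(2) in \<open>auto simp: AE_measure_pmf_iff\<close>)

lemma expectation_fst_pair_pmf:
  fixes f :: "'a \<Rightarrow> real"
  shows "measure_pmf.expectation (pair_pmf P Q) (\<lambda>z. f (fst z)) = measure_pmf.expectation P f"
  using integral_map_pmf[of fst "pair_pmf P Q" f] by (simp add: map_fst_pair_pmf)

lemma expectation_snd_pair_pmf:
  fixes f :: "'b \<Rightarrow> real"
  shows "measure_pmf.expectation (pair_pmf P Q) (\<lambda>z. f (snd z)) = measure_pmf.expectation Q f"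
  using integral_map_pmf[of snd "pair_pmf P Q" f] by (simp add: map_snd_pair_pmf)

section \<open>Support and expectation of a single step\<close>

text \<open>Six sampling schemes produce only two kinds of update, so pointwise estimates are needed
  for \<open>add_vertex\<close> and \<open>add_edges\<close> only.\<close>

lemma cf_op_step_cases:
  assumes "wf_multigraph G" "H \<in> set_pmf (cf_op_step i G x)"
  obtains vs where "set vs \<subseteq> verts G" "length vs = x" "H = add_vertex G vs" "i \<in> {Op_a, Op_b}"
    | v vs where "v \<in> verts G" "set vs \<subseteq> verts G" "length vs = x" "H = add_edges G v vs"
        "i \<notin> {Op_a, Op_b}"
proof -
  note s = set_pmf_uniform_vertex[OF assms(1)] set_pmf_rho0[OF assms(1)]
  show ?thesis
  proof (cases "i \<in> {Op_a, Op_b}")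
    case True
    hence "\<exists>vs. set vs \<subseteq> verts G \<and> length vs = x \<and> H = add_vertex G vs"
      using assms(2) s by (auto simp: set_replicate_pmf lists_eq_set) blast+
    thus ?thesis using that True by blast
  next
    case False
    have *: "set vs \<subseteq> verts G" if "set vs \<subseteq> set_pmf (rho0 G)" for vs
      using that s by blast
    from False have "\<exists>v vs. v \<in> verts G \<and> set vs \<subseteq> verts G \<and> length vs = x \<and> H = add_edges G v vs"
    proof (cases i)
      case Op_c
      then obtain vs where "set vs \<subseteq> verts G" "length vs = Suc x" "H = add_edges G (hd vs) (tl vs)"
        using assms(2) s by (auto simp: set_replicate_pmf lists_eq_set simp del: replicate_pmf.simps)
      thus ?thesis by (intro exI[of _ "hd vs"] exI[of _ "tl vs"]) (auto simp: length_Suc_conv)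
    next
      case Op_f
      then obtain vs where "set vs \<subseteq> verts G" "length vs = Suc x" "H = add_edges G (hd vs) (tl vs)"
        using assms(2) s by (auto simp: set_replicate_pmf lists_eq_set simp del: replicate_pmf.simps)
      thus ?thesis by (intro exI[of _ "hd vs"] exI[of _ "tl vs"]) (auto simp: length_Suc_conv)
    next
      case Op_d
      thus ?thesis using assms(2) s * by (auto simp: set_replicate_pmf lists_eq_set) blast
    next
      case Op_e
      thus ?thesis using assms(2) s * by (auto simp: set_replicate_pmf lists_eq_set)
    qed simp_all
    thus ?thesis using that False by blast
  qed
qed

lemma finite_set_cf_op_step:
  assumes "wf_multigraph G"
  shows "finite (set_pmf (cf_op_step i G x))"
proof -
  have V: "finite (verts G)" using assms by (simp add: wf_multigraph_def)
  have u: "finite (set_pmf (uniform_vertex G))" using V set_pmf_uniform_vertex[OF assms] by simp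
  have r: "finite (set_pmf (rho0 G))" using V set_pmf_rho0[OF assms] finite_subset by blast
  show ?thesis
    by (cases i) (auto intro!: finite_imageI finite_cartesian_product finite_set_replicate_pmf u r
        simp del: replicate_pmf.simps)
qed

text \<open>A pointwise bound affine in the sampled values of \<open>f\<close> passes to the mean:
  the first sample contributes \<open>B\<close>, all \<open>x\<close> samples contribute
  \<open>C\<close> each, and all have law \<open>P\<close>. The hypothesis \<open>x \<ge> 1\<close>
  ensures that \<open>hd vs\<close> is a sample.\<close>

lemma expectation_add_vertex_le:
  fixes s :: "multigraph \<Rightarrow> real"
  assumes P: "finite (set_pmf P)" "set_pmf P \<subseteq> V" and x: "x \<ge> 1"
    and s: "\<And>vs. set vs \<subseteq> V \<Longrightarrow> length vs = x \<Longrightarrow>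
      s (add_vertex G vs) \<le> A + B * f (hd vs) + C * (\<Sum>w\<leftarrow>vs. f w)"
  shows "measure_pmf.expectation (map_pmf (add_vertex G) (replicate_pmf x P)) s
    \<le> A + (B + C * real x) * measure_pmf.expectation P f"
proof -
  obtain y where y: "x = Suc y" using x by (cases x) auto
  note fin = finite_set_replicate_pmf[OF P(1)]
  note int = integrable_measure_pmf_finite[OF fin]
  have "measure_pmf.expectation (map_pmf (add_vertex G) (replicate_pmf x P)) s \<le>
    measure_pmf.expectation (replicate_pmf x P) (\<lambda>vs. A + B * f (hd vs) + C * (\<Sum>w\<leftarrow>vs. f w))"
    unfolding integral_map_pmf
    by (intro expectation_le_pmf fin s) (use P(2) in \<open>auto simp: set_replicate_pmf\<close>)
  also have "\<dots> = A + B * measure_pmf.expectation (replicate_pmf x P) (\<lambda>vs. f (hd vs))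
      + C * measure_pmf.expectation (replicate_pmf x P) (\<lambda>vs. \<Sum>w\<leftarrow>vs. f w)"
    by (simp add: int)
  also have "\<dots> = A + (B + C * real x) * measure_pmf.expectation P f"
    unfolding y expectation_hd_replicate_pmf expectation_sum_list_replicate_pmf[OF P(1)]
    by (simp add: algebra_simps)
  finally show ?thesis .
qed

text \<open>For operations c and f: the common end and the other ends are drawn as one list with one
  law.\<close>

lemma expectation_add_edges_joint_le:
  fixes s :: "multigraph \<Rightarrow> real"
  assumes P: "finite (set_pmf P)" "set_pmf P \<subseteq> V"
    and s: "\<And>v vs. v \<in> V \<Longrightarrow> set vs \<subseteq> V \<Longrightarrow> length vs = x \<Longrightarrow>
      s (add_edges G v vs) \<le> A + C * (real x * f v + (\<Sum>w\<leftarrow>vs. f w))"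
  shows "measure_pmf.expectation (map_pmf (\<lambda>vs. add_edges G (hd vs) (tl vs)) (replicate_pmf (Suc x) P)) s
    \<le> A + C * real x * (measure_pmf.expectation P f + measure_pmf.expectation P f)"
proof -
  note fin = finite_set_replicate_pmf[OF P(1)]
  note int = integrable_measure_pmf_finite[OF fin]
  have "measure_pmf.expectation (map_pmf (\<lambda>vs. add_edges G (hd vs) (tl vs)) (replicate_pmf (Suc x) P)) s \<le>
    measure_pmf.expectation (replicate_pmf (Suc x) P)
      (\<lambda>vs. A + C * (real x * f (hd vs) + (\<Sum>w\<leftarrow>tl vs. f w)))"
    unfolding integral_map_pmf
  proof (intro expectation_le_pmf fin s)
    fix vs assume "vs \<in> set_pmf (replicate_pmf (Suc x) P)"
    hence "set vs \<subseteq> V" "length vs = Suc x"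
      using P(2) unfolding set_replicate_pmf by auto
    thus "hd vs \<in> V" "set (tl vs) \<subseteq> V" "length (tl vs) = x"
      by (auto simp: length_Suc_conv)
  qed
  also have "\<dots> = A + C * (real x * measure_pmf.expectation (replicate_pmf (Suc x) P) (\<lambda>vs. f (hd vs))
      + measure_pmf.expectation (replicate_pmf (Suc x) P) (\<lambda>vs. \<Sum>w\<leftarrow>tl vs. f w))"
    by (simp add: int del: replicate_pmf.simps)
  also have "measure_pmf.expectation (replicate_pmf (Suc x) P) (\<lambda>vs. \<Sum>w\<leftarrow>tl vs. f w) =
      measure_pmf.expectation (replicate_pmf x P) (\<lambda>vs. \<Sum>w\<leftarrow>vs. f w)"
    using integral_map_pmf[of tl "replicate_pmf (Suc x) P" "\<lambda>vs. \<Sum>w\<leftarrow>vs. f w"]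
    by (simp only: map_tl_replicate_pmf)
  finally show ?thesis
    unfolding expectation_hd_replicate_pmf expectation_sum_list_replicate_pmf[OF P(1)]
    by (simp add: algebra_simps)
qed

text \<open>For operations d and e: the common end has law \<open>P\<close>, the other ends have law
  \<open>Q\<close>.\<close>

lemma expectation_add_edges_pair_le:
  fixes s :: "multigraph \<Rightarrow> real"
  assumes P: "finite (set_pmf P)" "set_pmf P \<subseteq> V" and Q: "finite (set_pmf Q)" "set_pmf Q \<subseteq> V"
    and s: "\<And>v vs. v \<in> V \<Longrightarrow> set vs \<subseteq> V \<Longrightarrow> length vs = x \<Longrightarrow>
      s (add_edges G v vs) \<le> A + C * (real x * f v + (\<Sum>w\<leftarrow>vs. f w))"
  shows "measure_pmf.expectation (map_pmf (\<lambda>(v, vs). add_edges G v vs) (pair_pmf P (replicate_pmf x Q))) s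
    \<le> A + C * real x * (measure_pmf.expectation P f + measure_pmf.expectation Q f)"
proof -
  have fin: "finite (set_pmf (pair_pmf P (replicate_pmf x Q)))"
    using finite_set_replicate_pmf[OF Q(1)] P(1) by simp
  note int = integrable_measure_pmf_finite[OF fin]
  have "measure_pmf.expectation (map_pmf (\<lambda>(v, vs). add_edges G v vs) (pair_pmf P (replicate_pmf x Q))) s \<le>
    measure_pmf.expectation (pair_pmf P (replicate_pmf x Q))
      (\<lambda>z. A + C * (real x * f (fst z) + (\<Sum>w\<leftarrow>snd z. f w)))"
    unfolding integral_map_pmf split_beta
    by (intro expectation_le_pmf fin s) (use P(2) Q(2) in \<open>auto simp: set_replicate_pmf\<close>)
  also have "\<dots> = A + C * (real x * measure_pmf.expectation (pair_pmf P (replicate_pmf x Q)) (\<lambda>z. f (fst z))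
      + measure_pmf.expectation (pair_pmf P (replicate_pmf x Q)) (\<lambda>z. \<Sum>w\<leftarrow>snd z. f w))"
    by (simp add: int)
  finally show ?thesis
    unfolding expectation_fst_pair_pmf expectation_snd_pair_pmf[of P _ "\<lambda>vs. \<Sum>w\<leftarrow>vs. f w"]
      expectation_sum_list_replicate_pmf[OF Q(1)]
    by (simp add: algebra_simps)
qed

lemma UNIV_cf_op: "UNIV = {Op_a, Op_b, Op_c, Op_d, Op_e, Op_f}"
  using cf_op.exhaust by auto

lemma finite_UNIV_cf_op: "finite (UNIV :: cf_op set)"
  unfolding UNIV_cf_op by simp

lemma pmf_embed_cf_op:
  assumes "\<And>i. p i \<ge> 0"
    and "p Op_a + p Op_b + p Op_c + p Op_d + p Op_e + p Op_f = 1"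
  shows "pmf (embed_pmf p) i = p i"
proof (rule pmf_embed_pmf)
  have "(\<integral>\<^sup>+i. ennreal (p i) \<partial>count_space UNIV) = (\<Sum>i\<in>UNIV. ennreal (p i))"
    by (rule nn_integral_count_space_finite[OF finite_UNIV_cf_op])
  also have "\<dots> = ennreal (\<Sum>i\<in>UNIV. p i)" by (rule sum_ennreal) (use assms in auto)
  also have "(\<Sum>i\<in>UNIV. p i) = 1" using assms by (simp add: UNIV_cf_op)
  finally show "(\<integral>\<^sup>+i. ennreal (p i) \<partial>count_space UNIV) = 1" by simp
qed (use assms in auto)

text \<open>Averages the pointwise bounds over the operation. The factors 2 arise because in
  operation c both ends of an edge are uniform and in f both are degree-biased, while d and e have
  one end of each kind.\<close>

lemma expectation_cf_step_le:
  fixes s f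
  assumes p: "\<And>i. p i \<ge> 0" "p Op_a + p Op_b + p Op_c + p Op_d + p Op_e + p Op_f = 1"
    and G: "wf_multigraph G" and x: "x \<ge> 1"
    and sv: "\<And>vs. set vs \<subseteq> verts G \<Longrightarrow> length vs = x \<Longrightarrow>
      s (add_vertex G vs) \<le> A1 + B * f (hd vs) + C1 * (\<Sum>w\<leftarrow>vs. f w)"
    and se: "\<And>v vs. v \<in> verts G \<Longrightarrow> set vs \<subseteq> verts G \<Longrightarrow> length vs = x \<Longrightarrow>
      s (add_edges G v vs) \<le> A2 + C2 * (real x * f v + (\<Sum>w\<leftarrow>vs. f w))"
  defines "mu \<equiv> measure_pmf.expectation (uniform_vertex G) f"
  defines "mr \<equiv> measure_pmf.expectation (rho0 G) f"
  shows "measure_pmf.expectation (cf_step p G x) s \<le>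
    (p Op_a + p Op_b) * A1 + (1 - (p Op_a + p Op_b)) * A2
    + (p Op_a * (B + C1 * real x) + (2 * p Op_c + p Op_d + p Op_e) * (C2 * real x)) * mu
    + (p Op_b * (B + C1 * real x) + (p Op_d + p Op_e + 2 * p Op_f) * (C2 * real x)) * mr"
proof -
  have V: "finite (verts G)" using G by (simp add: wf_multigraph_def)
  have u: "finite (set_pmf (uniform_vertex G))" "set_pmf (uniform_vertex G) \<subseteq> verts G"
    using V set_pmf_uniform_vertex[OF G] by simp_all
  have r: "finite (set_pmf (rho0 G))" "set_pmf (rho0 G) \<subseteq> verts G"
    using V set_pmf_rho0[OF G] finite_subset by blast+
  have ex: "measure_pmf.expectation (cf_step p G x) s =
      (\<Sum>i\<in>UNIV. p i * measure_pmf.expectation (cf_op_step i G x) s)"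
    unfolding cf_step_def
    by (subst pmf_expectation_bind[of UNIV])
       (use finite_set_cf_op_step[OF G] in \<open>simp_all add: pmf_embed_cf_op[OF p] finite_UNIV_cf_op\<close>)
  have a: "measure_pmf.expectation (cf_op_step Op_a G x) s \<le> A1 + (B + C1 * real x) * mu"
    unfolding cf_op_step.simps mu_def by (rule expectation_add_vertex_le[OF u x sv])
  have b: "measure_pmf.expectation (cf_op_step Op_b G x) s \<le> A1 + (B + C1 * real x) * mr"
    unfolding cf_op_step.simps mr_def by (rule expectation_add_vertex_le[OF r x sv])
  have c: "measure_pmf.expectation (cf_op_step Op_c G x) s \<le> A2 + C2 * real x * (mu + mu)"
    unfolding cf_op_step.simps mu_def by (rule expectation_add_edges_joint_le[OF u se])
  have d: "measure_pmf.expectation (cf_op_step Op_d G x) s \<le> A2 + C2 * real x * (mu + mr)"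
    unfolding cf_op_step.simps mu_def mr_def by (rule expectation_add_edges_pair_le[OF u r se])
  have e: "measure_pmf.expectation (cf_op_step Op_e G x) s \<le> A2 + C2 * real x * (mr + mu)"
    unfolding cf_op_step.simps mu_def mr_def by (rule expectation_add_edges_pair_le[OF r u se])
  have f: "measure_pmf.expectation (cf_op_step Op_f G x) s \<le> A2 + C2 * real x * (mr + mr)"
    unfolding cf_op_step.simps mr_def by (rule expectation_add_edges_joint_le[OF r se])
  have "measure_pmf.expectation (cf_step p G x) s \<le>
      p Op_a * (A1 + (B + C1 * real x) * mu) + p Op_b * (A1 + (B + C1 * real x) * mr)
      + p Op_c * (A2 + C2 * real x * (mu + mu)) + p Op_d * (A2 + C2 * real x * (mu + mr))
      + p Op_e * (A2 + C2 * real x * (mr + mu)) + p Op_f * (A2 + C2 * real x * (mr + mr))"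
    unfolding ex
    using mult_left_mono[OF a p(1)[of Op_a]] mult_left_mono[OF b p(1)[of Op_b]]
      mult_left_mono[OF c p(1)[of Op_c]] mult_left_mono[OF d p(1)[of Op_d]]
      mult_left_mono[OF e p(1)[of Op_e]] mult_left_mono[OF f p(1)[of Op_f]]
    by (simp add: UNIV_cf_op del: cf_op_step.simps)
  also have "\<dots> = (p Op_a + p Op_b) * A1 + (p Op_c + p Op_d + p Op_e + p Op_f) * A2
    + (p Op_a * (B + C1 * real x) + (2 * p Op_c + p Op_d + p Op_e) * (C2 * real x)) * mu
    + (p Op_b * (B + C1 * real x) + (p Op_d + p Op_e + 2 * p Op_f) * (C2 * real x)) * mr"
    by (simp add: algebra_simps)
  also have "p Op_c + p Op_d + p Op_e + p Op_f = 1 - (p Op_a + p Op_b)" using p(2) by simp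
  finally show ?thesis .
qed

section \<open>Transfer to the process\<close>

context cooper_frieze
begin

section \<open>Integrating over one step of the process\<close>

text \<open>Integrating \<open>G_Suc\<close> removes the conditioning, since a conditional
  expectation has the mean of the original function. The measurability claims prepare the exchange
  of sum and integral that follows.\<close>

lemma nn_integral_pmf_cf_step:
  "(\<integral>\<^sup>+\<omega>. ennreal (pmf (cf_step p (G t \<omega>) (X (Suc t) \<omega>)) H) \<partial>M) =
     emeasure M {\<omega> \<in> space M. G (Suc t) \<omega> = H}"
  "(\<lambda>\<omega>. ennreal (pmf (cf_step p (G t \<omega>) (X (Suc t) \<omega>)) H)) \<in> borel_measurable M"
  "(\<lambda>\<omega>. indicator {H} (G (Suc t) \<omega>) :: ennreal) \<in> borel_measurable M"
proof -
  interpret S: finite_measure_subalgebra M "F t"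
    by unfold_locales (rule subalgebra_F)
  have meas_G: "G s \<in> measurable M (count_space UNIV)" for s
    using measurable_from_subalg[OF subalgebra_F measurable_G] .
  have "X (Suc t) \<in> measurable M (count_space {1..})"
    using measurable_from_subalg[OF subalgebra_F measurable_X] .
  hence meas_X: "X (Suc t) \<in> measurable M (count_space UNIV)"
    by (rule measurable_compose[OF _ measurable_count_space])
  have A: "{\<omega> \<in> space M. G (Suc t) \<omega> = H} \<in> sets M"
    using measurable_sets[OF meas_G, of "{H}" "Suc t"] by (simp add: vimage_def Int_def conj_commute)
  \<comment> \<open>\<open>X (Suc t)\<close> takes countably many values, so measurability can be
    checked with its value frozen.\<close>
  have meas: "(\<lambda>\<omega>. pmf (cf_step p (G t \<omega>) (X (Suc t) \<omega>)) H) \<in> borel_measurable M"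
  proof (rule measurable_compose_countable[OF _ meas_X])
    fix x
    show "(\<lambda>\<omega>. pmf (cf_step p (G t \<omega>) x) H) \<in> borel_measurable M"
      by (rule measurable_compose[OF meas_G]) simp
  qed
  thus "(\<lambda>\<omega>. ennreal (pmf (cf_step p (G t \<omega>) (X (Suc t) \<omega>)) H)) \<in> borel_measurable M"
    by simp
  show "(\<lambda>\<omega>. indicator {H} (G (Suc t) \<omega>) :: ennreal) \<in> borel_measurable M"
    by (rule measurable_compose[OF meas_G]) simp
  have int: "integrable M (indicat_real {\<omega> \<in> space M. G (Suc t) \<omega> = H})"
    using A by (intro integrable_real_indicator) (auto simp: emeasure_eq_measure)
  have intp: "integrable M (\<lambda>\<omega>. pmf (cf_step p (G t \<omega>) (X (Suc t) \<omega>)) H)"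
    by (rule integrable_const_bound[of _ 1]) (use meas in \<open>auto simp: pmf_le_1\<close>)
  have "(\<integral>\<^sup>+\<omega>. ennreal (pmf (cf_step p (G t \<omega>) (X (Suc t) \<omega>)) H) \<partial>M) =
        ennreal (\<integral>\<omega>. pmf (cf_step p (G t \<omega>) (X (Suc t) \<omega>)) H \<partial>M)"
    by (rule nn_integral_eq_integral[OF intp]) simp
  also have "(\<integral>\<omega>. pmf (cf_step p (G t \<omega>) (X (Suc t) \<omega>)) H \<partial>M) =
      (\<integral>\<omega>. real_cond_exp M (F t) (indicat_real {\<omega> \<in> space M. G (Suc t) \<omega> = H}) \<omega> \<partial>M)"
  proof (rule integral_cong_AE)
    show "AE \<omega> in M. pmf (cf_step p (G t \<omega>) (X (Suc t) \<omega>)) H =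
        real_cond_exp M (F t) (indicat_real {\<omega> \<in> space M. G (Suc t) \<omega> = H}) \<omega>"
      using G_Suc[of t H] by eventually_elim simp
  qed (use meas in simp_all)
  also have "\<dots> = (\<integral>\<omega>. indicat_real {\<omega> \<in> space M. G (Suc t) \<omega> = H} \<omega> \<partial>M)"
    by (rule S.real_cond_exp_int(2)[OF int])
  also have "\<dots> = measure M {\<omega> \<in> space M. G (Suc t) \<omega> = H}"
    using A by simp
  finally show "(\<integral>\<^sup>+\<omega>. ennreal (pmf (cf_step p (G t \<omega>) (X (Suc t) \<omega>)) H) \<partial>M) =
     emeasure M {\<omega> \<in> space M. G (Suc t) \<omega> = H}"
    by (simp add: emeasure_eq_measure)
qed

lemma measurable_G_M: "G s \<in> measurable M (count_space UNIV)"
  using measurable_from_subalg[OF subalgebra_F measurable_G] .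

text \<open>Only the laws of singletons are given, so \<open>f (G (Suc t))\<close> is expanded over
  the countable set \<open>B\<close>, and sum and integral are exchanged twice. The function 1 then
  shows that \<open>B\<close> carries all the mass, which proves the first claim and allows the
  indicator of \<open>B\<close> to be dropped in the second.\<close>

lemma
  fixes f :: "multigraph \<Rightarrow> ennreal"
  assumes A: "AE \<omega> in M. G t \<omega> \<in> A" and B: "countable B"
    and supp: "\<And>H \<omega>. H \<in> A \<Longrightarrow> \<omega> \<in> space M \<Longrightarrow> set_pmf (cf_step p H (X (Suc t) \<omega>)) \<subseteq> B"
  shows AE_G_Suc: "AE \<omega> in M. G (Suc t) \<omega> \<in> B"
    and nn_integral_G_Suc: "(\<integral>\<^sup>+\<omega>. f (G (Suc t) \<omega>) \<partial>M) =
      (\<integral>\<^sup>+\<omega>. (\<integral>\<^sup>+H. f H \<partial>measure_pmf (cf_step p (G t \<omega>) (X (Suc t) \<omega>))) \<partial>M)"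
proof -
  let ?K = "\<lambda>\<omega>. cf_step p (G t \<omega>) (X (Suc t) \<omega>)"
  \<comment> \<open>Stated for every \<open>f\<close> with the indicator of \<open>B\<close> kept;
    it is used once for 1 and once for the given \<open>f\<close>.\<close>
  have *: "(\<integral>\<^sup>+\<omega>. f (G (Suc t) \<omega>) * indicator B (G (Suc t) \<omega>) \<partial>M) =
      (\<integral>\<^sup>+\<omega>. (\<integral>\<^sup>+H. f H \<partial>measure_pmf (?K \<omega>)) \<partial>M)" for f :: "multigraph \<Rightarrow> ennreal"
  proof -
    have "f H * indicator B H = (\<integral>\<^sup>+H'. f H' * indicator {H'} H \<partial>count_space B)" for H
    proof (cases "H \<in> B")
      case True
      have "(\<integral>\<^sup>+H'. f H' * indicator {H'} H \<partial>count_space B) = (\<Sum>H'\<in>{H}. f H' * indicator {H'} H)"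
        by (rule nn_integral_count_space') (use True in \<open>auto simp: indicator_def\<close>)
      thus ?thesis using True by simp
    next
      case False
      hence "(\<integral>\<^sup>+H'. f H' * indicator {H'} H \<partial>count_space B) = (\<integral>\<^sup>+H'. 0 \<partial>count_space B)"
        by (intro nn_integral_cong) (auto simp: indicator_def)
      thus ?thesis using False by simp
    qed
    hence "(\<integral>\<^sup>+\<omega>. f (G (Suc t) \<omega>) * indicator B (G (Suc t) \<omega>) \<partial>M) =
        (\<integral>\<^sup>+\<omega>. (\<integral>\<^sup>+H. f H * indicator {H} (G (Suc t) \<omega>) \<partial>count_space B) \<partial>M)"
      by simp
    also have "\<dots> = (\<integral>\<^sup>+H. (\<integral>\<^sup>+\<omega>. f H * indicator {H} (G (Suc t) \<omega>) \<partial>M) \<partial>count_space B)"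
      by (rule nn_integral_count_space_nn_integral[OF B])
         (intro borel_measurable_times_ennreal nn_integral_pmf_cf_step(3), simp)
    also have "\<dots> = (\<integral>\<^sup>+H. (\<integral>\<^sup>+\<omega>. f H * ennreal (pmf (?K \<omega>) H) \<partial>M) \<partial>count_space B)"
    proof (rule nn_integral_cong)
      fix H
      have "(\<integral>\<^sup>+\<omega>. indicator {H} (G (Suc t) \<omega>) \<partial>M) = 
         (\<integral>\<^sup>+\<omega>. indicator {\<omega>\<in>space M. G (Suc t) \<omega> = H} \<omega> \<partial>M)"
        by (rule nn_integral_cong) (simp add: indicator_def)
      also have "\<dots> = emeasure M {\<omega>\<in>space M. G (Suc t) \<omega> = H}"
        by (rule nn_integral_indicator)
           (use measurable_sets[OF measurable_G_M, of "{H}" "Suc t"]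
             in \<open>simp add: vimage_def Int_def conj_commute\<close>)
      finally show "(\<integral>\<^sup>+\<omega>. f H * indicator {H} (G (Suc t) \<omega>) \<partial>M) =
          (\<integral>\<^sup>+\<omega>. f H * ennreal (pmf (?K \<omega>) H) \<partial>M)"
        by (simp add: nn_integral_cmult nn_integral_pmf_cf_step)
    qed
    also have "\<dots> = (\<integral>\<^sup>+\<omega>. (\<integral>\<^sup>+H. f H * ennreal (pmf (?K \<omega>) H) \<partial>count_space B) \<partial>M)"
      by (rule nn_integral_count_space_nn_integral[OF B, symmetric])
         (intro borel_measurable_times_ennreal nn_integral_pmf_cf_step(2), simp)
    also have "\<dots> = (\<integral>\<^sup>+\<omega>. (\<integral>\<^sup>+H. f H \<partial>measure_pmf (?K \<omega>)) \<partial>M)"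
    proof (rule nn_integral_cong_AE)
      show "AE \<omega> in M. (\<integral>\<^sup>+H. f H * ennreal (pmf (?K \<omega>) H) \<partial>count_space B) =
          (\<integral>\<^sup>+H. f H \<partial>measure_pmf (?K \<omega>))"
        using A AE_space
      proof eventually_elim
        case (elim \<omega>)
        hence "set_pmf (?K \<omega>) \<subseteq> B" using supp by blast
        hence "(\<integral>\<^sup>+H. f H * ennreal (pmf (?K \<omega>) H) \<partial>count_space B) =
            (\<integral>\<^sup>+H. f H * ennreal (pmf (?K \<omega>) H) \<partial>count_space UNIV)"
          by (intro nn_integral_count_space_eq) (auto simp: pmf_eq_0_set_pmf)
        thus ?case by (simp add: nn_integral_measure_pmf mult.commute)
      qed
    qed
    finally show ?thesis .
  qed
  have mB: "{\<omega>\<in>space M. G (Suc t) \<omega> \<in> B} \<in> sets M"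
    using measurable_sets[OF measurable_G_M, of B "Suc t"]
    by (simp add: vimage_def Int_def conj_commute)
  have "emeasure M {\<omega>\<in>space M. G (Suc t) \<omega> \<in> B} =
      (\<integral>\<^sup>+\<omega>. indicator {\<omega>\<in>space M. G (Suc t) \<omega> \<in> B} \<omega> \<partial>M)"
    using mB by simp
  also have "\<dots> = (\<integral>\<^sup>+\<omega>. 1 * indicator B (G (Suc t) \<omega>) \<partial>M)"
    by (rule nn_integral_cong) (simp add: indicator_def)
  also have "\<dots> = 1" using *[of "\<lambda>_. 1"] by (simp add: emeasure_space_1)
  finally have "prob {\<omega>\<in>space M. G (Suc t) \<omega> \<in> B} = 1"
    by (simp add: emeasure_eq_measure)
  from AE_prob_1[OF this] show AE: "AE \<omega> in M. G (Suc t) \<omega> \<in> B" by auto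
  have "(\<integral>\<^sup>+\<omega>. f (G (Suc t) \<omega>) \<partial>M) = (\<integral>\<^sup>+\<omega>. f (G (Suc t) \<omega>) * indicator B (G (Suc t) \<omega>) \<partial>M)"
    by (rule nn_integral_cong_AE) (use AE in \<open>auto simp: indicator_def\<close>)
  thus "(\<integral>\<^sup>+\<omega>. f (G (Suc t) \<omega>) \<partial>M) = (\<integral>\<^sup>+\<omega>. (\<integral>\<^sup>+H. f H \<partial>measure_pmf (?K \<omega>)) \<partial>M)"
    unfolding * .
qed

end

section \<open>The supermartingale\<close>

text \<open>The lower bound on the edges controls the growth of the degree weight; the upper bound
  and the depth bound make the potential bounded while there are few vertices. Since each birth adds
  at most one level, the height is at most the initial height plus the number of vertices.\<close>

definition admissible :: "nat \<Rightarrow> multigraph \<Rightarrow> nat \<Rightarrow> nat \<Rightarrow> nat \<Rightarrow> nat \<Rightarrow> multigraph \<Rightarrow> bool" where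
  "admissible r G0 D l u t G \<longleftrightarrow> rooted r G \<and> card (verts G) \<le> card (verts G0) + t \<and>
     l * t \<le> size (edges G) \<and> size (edges G) \<le> size (edges G0) + u * t \<and>
     (\<forall>v\<in>verts G. depth r G v \<le> D + card (verts G))"

lemma admissible_cf_step:
  assumes G: "admissible r G0 D l u t G" and x: "l \<le> x" "x \<le> u" "x \<ge> 1"
    and H: "H \<in> set_pmf (cf_step p G x)"
  shows "admissible r G0 D l u (Suc t) H" "card (verts G) \<le> card (verts H)"
    "card (verts H) \<le> Suc (card (verts G))"
proof -
  have G': "rooted r G" "card (verts G) \<le> card (verts G0) + t" "l * t \<le> size (edges G)"
    "size (edges G) \<le> size (edges G0) + u * t"
    "\<And>v. v \<in> verts G \<Longrightarrow> depth r G v \<le> D + card (verts G)"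
    using G by (auto simp: admissible_def)
  have wf: "wf_multigraph G" using G' by (simp add: rooted_def)
  obtain i where "H \<in> set_pmf (cf_op_step i G x)" using H by (auto simp: cf_step_def)
  from cf_op_step_cases[OF wf this]
  have "admissible r G0 D l u (Suc t) H \<and> card (verts G) \<le> card (verts H) \<and>
      card (verts H) \<le> Suc (card (verts G))"
  proof cases
    case (1 vs)
    hence "vs \<noteq> []" using x by auto
    note A = rooted_add_vertex[OF G'(1) 1(1) this, folded 1(3)]
    show ?thesis using A(1-3) A(4)[OF G'(5)] G' x 1(2) by (auto simp: admissible_def)
  next
    case (2 v vs)
    note A = rooted_add_edges[OF G'(1) 2(1,2), folded 2(4)]
    show ?thesis using A(1-3) order_trans[OF A(4) G'(5)] G' x 2(3) by (auto simp: admissible_def)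
  qed
  thus "admissible r G0 D l u (Suc t) H" "card (verts G) \<le> card (verts H)"
    "card (verts H) \<le> Suc (card (verts G))" by blast+
qed

text \<open>Used with \<open>\<beta> = q / u\<close>, which gives the \<Phi> + (q/u) \<Psi> of the
  overview.\<close>

definition depth_potential :: "nat \<Rightarrow> real \<Rightarrow> multigraph \<Rightarrow> real" where
  "depth_potential r \<beta> G = vertex_weight r G + \<beta> * degree_weight r G"

lemma vertex_weight_nonneg: "vertex_weight r G \<ge> 0" by (simp add: vertex_weight_def sum_nonneg)
lemma degree_weight_nonneg: "degree_weight r G \<ge> 0" by (simp add: degree_weight_def sum_nonneg)

lemma depth_potential_nonneg: "\<beta> \<ge> 0 \<Longrightarrow> depth_potential r \<beta> G \<ge> 0"
  by (simp add: depth_potential_def vertex_weight_nonneg degree_weight_nonneg)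

lemma depth_potential_le:
  assumes "wf_multigraph G" "\<And>v. v \<in> verts G \<Longrightarrow> depth r G v \<le> d" "\<beta> \<ge> 0"
  shows "depth_potential r \<beta> G \<le>
    (real (card (verts G)) + 2 * (\<beta> * real (size (edges G)))) * exp (real d)"
proof -
  have "vertex_weight r G \<le> (\<Sum>v\<in>verts G. exp (real d))"
    unfolding vertex_weight_def by (intro sum_mono) (use assms in auto)
  moreover have "degree_weight r G \<le> (\<Sum>v\<in>verts G. real (deg G v) * exp (real d))"
    unfolding degree_weight_def by (intro sum_mono mult_left_mono) (use assms in auto)
  hence "degree_weight r G \<le> 2 * real (size (edges G)) * exp (real d)"
    unfolding sum_distrib_right[symmetric] sum_deg[OF assms(1)] .
  hence "\<beta> * degree_weight r G \<le> \<beta> * (2 * real (size (edges G)) * exp (real d))"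
    by (rule mult_left_mono[OF _ assms(3)])
  ultimately show ?thesis by (simp add: depth_potential_def algebra_simps)
qed

text \<open>Junk value: \<open>vertex_decay m = 0\<close> for \<open>m < 8\<close>.\<close>

definition vertex_decay :: "nat \<Rightarrow> real" where
  "vertex_decay m = 1 / real ((m - 1) choose 7)"

lemma vertex_decay_pos: "m \<ge> 8 \<Longrightarrow> vertex_decay m > 0"
  by (simp add: vertex_decay_def zero_less_binomial)

text \<open>Absorption for binomial coefficients makes the ratio exactly \<open>1 - 7 / m\<close>,
  which is what a birth has to pay. The plain power m powr -7 would drop by too little, by
  Bernoulli's inequality.\<close>

lemma vertex_decay_Suc:
  assumes "m \<ge> 8"
  shows "vertex_decay (Suc m) = vertex_decay m * (1 - 7 / real m)"
proof -
  obtain k where k: "m = Suc k" using assms by (cases m) auto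
  have eq: "(Suc k - 7) * (Suc k choose 7) = Suc k * (k choose 7)"
    using binomial_absorb_comp[of "Suc k" 7] by simp
  hence "(real (Suc k) - 7) * real (Suc k choose 7) = real (Suc k) * real (k choose 7)"
  proof -
    have "real (Suc k) - 7 = real (Suc k - 7)" using assms k by simp
    thus ?thesis using arg_cong[OF eq, of real] by (simp only: of_nat_mult)
  qed
  moreover have "real (Suc k choose 7) > 0" "real (k choose 7) > 0"
    using assms k by (simp_all add: zero_less_binomial)
  moreover have "1 / A = 1 / B * (1 - 7 / K)"
    if "(K - 7) * A = K * B" "A > 0" "B > 0" "K > 0" for A B K :: real
    using that by (simp add: field_simps)
  ultimately show ?thesis by (simp add: vertex_decay_def k)
qed

lemma vertex_decay_le_1: "vertex_decay m \<le> 1"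
proof -
  have "1 / real n \<le> 1" for n by (cases n) simp_all
  thus ?thesis by (simp only: vertex_decay_def)
qed

lemma vertex_decay_ge:
  assumes "m \<ge> 8"
  shows "vertex_decay m \<ge> 1 / real m ^ 7"
proof -
  have "(m - 1) choose 7 \<le> (m - 1) ^ 7" by (rule binomial_le_pow) (use assms in simp)
  also have "\<dots> \<le> m ^ 7" by (rule power_mono) auto
  finally have "real ((m - 1) choose 7) \<le> real m ^ 7" by (metis of_nat_le_iff of_nat_power)
  thus ?thesis using assms unfolding vertex_decay_def
    by (intro divide_left_mono mult_pos_pos) (simp_all add: zero_less_binomial)
qed

text \<open>With few vertices a drop of \<open>vertex_decay\<close> cannot pay for the growth, because
  \<open>1 - 7 / m \<le> 0\<close> for \<open>m \<le> 7\<close>.  But then all depths are bounded, and \<open>K\<close> will dominate the potential at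
  the moment the graph reaches \<open>N\<close> vertices.  Taking \<open>N > |V(G 0)|\<close> also ensures that there are
  edges by then, so that \<open>rho0\<close> is given by the degrees.\<close>

definition stopped_potential :: "nat \<Rightarrow> nat \<Rightarrow> real \<Rightarrow> real \<Rightarrow> real \<Rightarrow> multigraph \<Rightarrow> real" where
  "stopped_potential r N K \<beta> c G =
     (if card (verts G) < N then K else c * vertex_decay (card (verts G)) * depth_potential r \<beta> G)"

section \<open>Drift of the potential in one step\<close>

text \<open>Births multiply the decay factor by \<open>1 - 7 / |V|\<close> with probability
  \<open>q\<close>, which cancels the growth caused by uniform samples. The growth caused by
  degree-biased samples remains as the relative increase 7u / (2|E|).\<close>

lemma expectation_depth_potential_step:
  assumes p: "\<And>i. p i \<ge> 0" "p Op_a + p Op_b + p Op_c + p Op_d + p Op_e + p Op_f = 1"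
    and q: "q = p Op_a + p Op_b" "q > 0"
    and G: "rooted r G" "card (verts G) \<ge> 8" "edges G \<noteq> {#}"
    and x: "x \<ge> 1" "x \<le> u"
  shows "measure_pmf.expectation (cf_step p G x)
      (\<lambda>H. vertex_decay (card (verts H)) * depth_potential r (q / real u) H)
    \<le> vertex_decay (card (verts G)) * depth_potential r (q / real u) G *
        (1 + 7 / 2 * real u / real (size (edges G)))"
proof -
  define V where "V = card (verts G)"
  define E where "E = real (size (edges G))"
  define \<beta> where "\<beta> = q / real u"
  define f where "f v = exp (real (depth r G v))" for v
  define g where "g = vertex_decay V"
  define g1 where "g1 = vertex_decay (Suc V)"
  define \<Phi> where "\<Phi> = vertex_weight r G"
  define \<Psi> where "\<Psi> = degree_weight r G"
  have wf: "wf_multigraph G" using G by (simp add: rooted_def)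
  have u: "real u > 0" using x by simp
  have \<beta>: "\<beta> > 0" using q u by (simp add: \<beta>_def)
  have E: "E > 0" using G(3) by (simp add: E_def nonempty_has_size)
  have V: "real V > 0" "V \<ge> 8" using G(2) by (auto simp: V_def)
  have g: "g > 0" "g1 = g * (1 - 7 / real V)" "g1 > 0"
    using V by (auto simp: g_def g1_def vertex_decay_pos vertex_decay_Suc)
  have "g1 \<le> g" unfolding g(2) using g(1) V by (intro mult_left_le) auto
  have mu: "measure_pmf.expectation (uniform_vertex G) f = \<Phi> / real V"
    using expectation_uniform_vertex[OF wf, of f] by (simp add: f_def[abs_def] vertex_weight_def \<Phi>_def V_def)
  have mr: "measure_pmf.expectation (rho0 G) f = \<Psi> / (2 * E)"
    using expectation_rho0[OF wf G(3), of f] by (simp add: f_def[abs_def] degree_weight_def \<Psi>_def E_def)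
  have nn: "\<Phi> \<ge> 0" "\<Psi> \<ge> 0" by (simp_all add: \<Phi>_def \<Psi>_def vertex_weight_nonneg degree_weight_nonneg)
  have e: "exp (1::real) \<le> 3" by (rule exp_le)
  let ?s = "\<lambda>H. vertex_decay (card (verts H)) * depth_potential r \<beta> H"
  have sv: "?s (add_vertex G vs) \<le> g1 * (\<Phi> + \<beta> * \<Psi>) + (g1 * (exp 1 + \<beta> * real x * exp 1)) * f (hd vs)
      + (g1 * \<beta>) * (\<Sum>w\<leftarrow>vs. f w)"
    if vs: "set vs \<subseteq> verts G" "length vs = x" for vs
  proof -
    have "vs \<noteq> []" using vs x by auto
    note A = rooted_add_vertex[OF G(1) vs(1) this]
    have "depth_potential r \<beta> (add_vertex G vs) \<le> (\<Phi> + exp 1 * f (hd vs)) +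
        \<beta> * (\<Psi> + real x * (exp 1 * f (hd vs)) + (\<Sum>w\<leftarrow>vs. f w))"
      unfolding depth_potential_def
      by (intro add_mono mult_left_mono) (use A(5,6) vs \<beta> in \<open>auto simp: f_def \<Phi>_def \<Psi>_def\<close>)
    hence "g1 * depth_potential r \<beta> (add_vertex G vs) \<le> g1 * ((\<Phi> + exp 1 * f (hd vs)) +
        \<beta> * (\<Psi> + real x * (exp 1 * f (hd vs)) + (\<Sum>w\<leftarrow>vs. f w)))"
      by (rule mult_left_mono) (use g in simp)
    thus ?thesis by (simp add: A(1) g1_def V_def algebra_simps)
  qed
  have se: "?s (add_edges G v vs) \<le> g * (\<Phi> + \<beta> * \<Psi>) + (g * \<beta>) * (real x * f v + (\<Sum>w\<leftarrow>vs. f w))"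
    if vs: "v \<in> verts G" "set vs \<subseteq> verts G" "length vs = x" for v vs
  proof -
    note A = rooted_add_edges[OF G(1) vs(1,2)]
    have "depth_potential r \<beta> (add_edges G v vs) \<le> \<Phi> + \<beta> * (\<Psi> + real x * f v + (\<Sum>w\<leftarrow>vs. f w))"
      unfolding depth_potential_def
      by (intro add_mono mult_left_mono) (use A(5,6) vs \<beta> in \<open>auto simp: f_def \<Phi>_def \<Psi>_def\<close>)
    hence "g * depth_potential r \<beta> (add_edges G v vs) \<le>
        g * (\<Phi> + \<beta> * (\<Psi> + real x * f v + (\<Sum>w\<leftarrow>vs. f w)))"
      by (rule mult_left_mono) (use g in simp)
    thus ?thesis by (simp add: A(1) g_def V_def algebra_simps)
  qed
  \<comment> \<open>This is the reason for \<open>\<beta> = q / u\<close>: the degree weight of all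
    edges added in one step costs at most a multiple of \<open>q\<close>.\<close>
  have bx: "\<beta> * real x \<le> q" "\<beta> * real x \<ge> 0" using x u q(2) by (simp_all add: \<beta>_def field_simps)
  \<comment> \<open>Here \<open>a\<close> is the probability of a birth using one of the two laws
    and \<open>b\<close> the mean number of edge ends with that law, per edge, in the other
    operations. From \<open>exp 1 \<le> 3\<close> and \<open>4 * a + b \<le> 4\<close> the constant
    is 7 = 3 + 4, which fixes the 7 in \<open>vertex_decay\<close>.\<close>
  have coeff: "a * (g1 * (exp 1 + \<beta> * real x * exp 1) + g1 * \<beta> * real x) + b * (g * \<beta> * real x) \<le> 7 * g * q"
    if "a \<ge> 0" "a \<le> q" "b \<ge> 0" "a + b / 2 \<le> 1" for a b
  proof -
    have "a * (g1 * (exp 1 + \<beta> * real x * exp 1) + g1 * \<beta> * real x) =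
        g1 * (a * (exp 1 + \<beta> * real x * (exp 1 + 1)))"
      by (simp add: algebra_simps)
    also have "\<dots> \<le> g * (a * (3 + \<beta> * real x * 4))"
      using that bx g e \<open>g1 \<le> g\<close> by (intro mult_mono mult_left_mono add_mono) auto
    finally have "a * (g1 * (exp 1 + \<beta> * real x * exp 1) + g1 * \<beta> * real x) + b * (g * \<beta> * real x)
        \<le> g * (3 * a + \<beta> * real x * (4 * a + b))"
      by (simp add: algebra_simps)
    also have "\<dots> \<le> g * (3 * q + q * 4)"
      using that bx g by (intro mult_left_mono add_mono mult_mono) auto
    finally show ?thesis by (simp add: algebra_simps)
  qed
  have "measure_pmf.expectation (cf_step p G x) ?s \<le>
      q * (g1 * (\<Phi> + \<beta> * \<Psi>)) + (1 - q) * (g * (\<Phi> + \<beta> * \<Psi>)) +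
    (p Op_a * (g1 * (exp 1 + \<beta> * real x * exp 1) + g1 * \<beta> * real x) +
      (2 * p Op_c + p Op_d + p Op_e) * (g * \<beta> * real x)) * (\<Phi> / real V) +
    (p Op_b * (g1 * (exp 1 + \<beta> * real x * exp 1) + g1 * \<beta> * real x) +
      (p Op_d + p Op_e + 2 * p Op_f) * (g * \<beta> * real x)) * (\<Psi> / (2 * E))"
    using expectation_cf_step_le[OF p wf x(1) sv se] unfolding mu mr q(1) .
  also have "\<dots> \<le> q * (g1 * (\<Phi> + \<beta> * \<Psi>)) + (1 - q) * (g * (\<Phi> + \<beta> * \<Psi>)) +
      (7 * g * q) * (\<Phi> / real V) + (7 * g * q) * (\<Psi> / (2 * E))"
  proof -
    note pn = p(1)[of Op_a] p(1)[of Op_b] p(1)[of Op_c] p(1)[of Op_d] p(1)[of Op_e] p(1)[of Op_f]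
    have ab: "p Op_a + (2 * p Op_c + p Op_d + p Op_e) / 2 \<le> 1"
      "p Op_b + (p Op_d + p Op_e + 2 * p Op_f) / 2 \<le> 1"
      using pn p(2) by argo+
    have "p Op_a * (g1 * (exp 1 + \<beta> * real x * exp 1) + g1 * \<beta> * real x) +
        (2 * p Op_c + p Op_d + p Op_e) * (g * \<beta> * real x) \<le> 7 * g * q"
      by (rule coeff) (use pn ab q in auto)
    moreover have "p Op_b * (g1 * (exp 1 + \<beta> * real x * exp 1) + g1 * \<beta> * real x) +
        (p Op_d + p Op_e + 2 * p Op_f) * (g * \<beta> * real x) \<le> 7 * g * q"
      by (rule coeff) (use pn ab q in auto)
    ultimately show ?thesis
      by (intro add_mono mult_right_mono order_refl) (use nn V E in auto)
  qed
  \<comment> \<open>The \<Phi> part of the drop of \<open>g1\<close> against \<open>g\<close>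
    cancels the uniform term exactly; its \<Psi> part is negative and is discarded next.\<close>
  also have "\<dots> = g * (\<Phi> + \<beta> * \<Psi> - 7 * q * (\<beta> * \<Psi>) / real V + 7 * q * \<Psi> / (2 * E))"
    unfolding g(2) using V E by (simp add: field_simps)
  also have "\<dots> \<le> g * ((\<Phi> + \<beta> * \<Psi>) * (1 + 7 / 2 * real u / E))"
  proof (rule mult_left_mono)
    have "7 * q * \<Psi> / (2 * E) = \<beta> * \<Psi> * (7 / 2 * real u / E)"
      using u E by (simp add: \<beta>_def field_simps)
    moreover have "7 * q * (\<beta> * \<Psi>) / real V \<ge> 0" using q \<beta> nn V by simp
    moreover have "\<Phi> * (7 / 2 * real u / E) \<ge> 0" using nn u E by simp
    ultimately show "\<Phi> + \<beta> * \<Psi> - 7 * q * (\<beta> * \<Psi>) / real V + 7 * q * \<Psi> / (2 * E) \<le>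
        (\<Phi> + \<beta> * \<Psi>) * (1 + 7 / 2 * real u / E)"
      unfolding distrib_left distrib_right mult_1_right by linarith
  qed (use g in simp)
  finally show ?thesis
    unfolding depth_potential_def g_def V_def E_def \<Phi>_def \<Psi>_def \<beta>_def by (simp only: mult.assoc)
qed

lemma finite_set_cf_step:
  assumes "wf_multigraph G"
  shows "finite (set_pmf (cf_step p G x))"
proof -
  have "finite (set_pmf (embed_pmf p))" by (rule finite_subset[OF subset_UNIV finite_UNIV_cf_op])
  thus ?thesis using finite_set_cf_op_step[OF assms] by (auto simp: cf_step_def)
qed

lemma nn_integral_pmf_le_const:
  assumes "\<And>x. x \<in> set_pmf P \<Longrightarrow> f x \<le> (c::ennreal)"
  shows "(\<integral>\<^sup>+x. f x \<partial>measure_pmf P) \<le> c"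
proof -
  have "(\<integral>\<^sup>+x. f x \<partial>measure_pmf P) \<le> (\<integral>\<^sup>+x. c \<partial>measure_pmf P)"
    by (rule nn_integral_mono_AE) (use assms in \<open>auto simp: AE_measure_pmf_iff\<close>)
  thus ?thesis by (simp add: measure_pmf.emeasure_space_1)
qed

section \<open>The decay in time and the supermartingale inequality\<close>

text \<open>Of order t powr -L for fixed \<open>L\<close>. As an exponential of a harmonic sum it
  loses exactly the factor \<open>exp (- L / t)\<close> in one step, which compensates
  \<open>1 + L / t\<close> because 1 + x \<le> exp x.\<close>

definition time_decay :: "real \<Rightarrow> nat \<Rightarrow> real" where
  "time_decay L t = exp (- L * (\<Sum>s=1..<t. 1 / real s))"

lemma time_decay_Suc:
  assumes "t \<ge> 1"
  shows "time_decay L (Suc t) * (1 + L / real t) \<le> time_decay L t"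
proof -
  have "time_decay L (Suc t) = time_decay L t * exp (- (L / real t))"
    using assms by (simp add: time_decay_def distrib_left flip: exp_add)
  hence "time_decay L (Suc t) * (1 + L / real t) \<le> time_decay L t * exp (- (L / real t)) * exp (L / real t)"
    by (simp add: time_decay_def exp_ge_add_one_self)
  thus ?thesis by (simp add: mult.assoc flip: exp_add)
qed

lemma sum_inverse_le_ln:
  assumes "n \<ge> 1"
  shows "(\<Sum>s=1..<n. 1 / real s) \<le> 1 + ln (real n)"
proof -
  have "(\<Sum>s=1..n. 1 / real s) \<le> 1 + ln (real n)"
    using assms
  proof (induction n rule: dec_induct)
    case (step n)
    have "ln (real n / real (Suc n)) \<le> real n / real (Suc n) - 1"
      using step by (intro ln_le_minus_one) auto
    also have "\<dots> = - 1 / real (Suc n)" by (simp add: field_simps)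
    finally have "1 / real (Suc n) \<le> ln (real (Suc n)) - ln (real n)"
      using step by (simp add: ln_div)
    thus ?case using step by simp
  qed simp
  moreover have "(\<Sum>s=1..<n. 1 / real s) \<le> (\<Sum>s=1..n. 1 / real s)"
    by (intro sum_mono2) auto
  ultimately show ?thesis by simp
qed

lemma time_decay_le_1: "L \<ge> 0 \<Longrightarrow> time_decay L t \<le> 1"
  by (simp add: time_decay_def sum_nonneg)

lemma time_decay_pos: "time_decay L t > 0"
  by (simp add: time_decay_def)

text \<open>Below \<open>N\<close> vertices the value is \<open>K\<close>. A step adds at most one
  vertex, so the level \<open>N\<close> is hit exactly, and there all depths are at most
  \<open>D + N\<close>, so \<open>K\<close> dominates. From \<open>N\<close> vertices on, the drift
  bound applies and \<open>time_decay\<close> absorbs its factor.\<close>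

lemma stopped_potential_step:
  fixes q :: real and l u n N D :: nat and G0 :: multigraph
  defines "K \<equiv> (real N + 2 * real (size (edges G0) + n)) * exp (real (D + N))"
  defines "L \<equiv> 7 / 2 * (real u / real l)"
  assumes p: "\<And>i. p i \<ge> 0" "p Op_a + p Op_b + p Op_c + p Op_d + p Op_e + p Op_f = 1"
    and q: "q = p Op_a + p Op_b" "q > 0"
    and G: "admissible r G0 D l u t G" and t: "t < n"
    and x: "1 \<le> l" "l \<le> x" "x \<le> u"
    and N: "N = card (verts G0) + 8"
  shows "(\<integral>\<^sup>+H. ennreal (stopped_potential r N K (q / real u) (time_decay L (Suc t)) H) \<partial>measure_pmf (cf_step p G x))
    \<le> ennreal (stopped_potential r N K (q / real u) (time_decay L t) G)"
proof (cases "card (verts G) < N")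
  case True
  have u: "real u \<ge> 1" using x by simp
  have q1: "q \<le> 1" using p(1)[of Op_c] p(1)[of Op_d] p(1)[of Op_e] p(1)[of Op_f] p(2) q by linarith
  have K: "K \<ge> 0" by (simp add: K_def)
  show ?thesis
  proof (rule nn_integral_pmf_le_const, rule ennreal_leI)
    fix H assume H: "H \<in> set_pmf (cf_step p G x)"
    have x1: "x \<ge> 1" using x by simp
    note A = admissible_cf_step[OF G x(2,3) x1 H]
    have "time_decay L (Suc t) * vertex_decay N * depth_potential r (q / real u) H \<le> K" if card: "card (verts H) = N"
    proof -
      have "depth_potential r (q / real u) H \<le>
          (real N + 2 * (q / real u * real (size (edges H)))) * exp (real (D + N))"
        unfolding card[symmetric]
        by (rule depth_potential_le) (use A(1) q in \<open>auto simp: admissible_def rooted_def\<close>)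
      also have "\<dots> \<le> K" unfolding K_def
      proof (intro mult_right_mono add_left_mono mult_left_mono)
        \<comment> \<open>Since \<open>u \<ge> 1\<close>, the edge count is at most
          \<open>u * (size (edges G0) + n)\<close>. The factor \<open>q / u\<close> cancels
          \<open>u\<close>, so \<open>K\<close> is independent of \<open>u\<close>.\<close>
        have "size (edges H) \<le> size (edges G0) + u * Suc t" using A(1) by (simp add: admissible_def)
        also have "\<dots> \<le> u * size (edges G0) + u * n"
          using x t by (intro add_mono mult_left_mono) auto
        finally have "real (size (edges H)) \<le> real u * real (size (edges G0) + n)"
          by (metis distrib_left of_nat_le_iff of_nat_mult)
        hence "q / real u * real (size (edges H)) \<le> q / real u * (real u * real (size (edges G0) + n))"
          using q u by (intro mult_left_mono) auto
        also have "\<dots> = q * real (size (edges G0) + n)" using u by simp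
        also have "\<dots> \<le> 1 * real (size (edges G0) + n)" by (intro mult_right_mono q1) simp
        finally show "q / real u * real (size (edges H)) \<le> real (size (edges G0) + n)" by simp
      qed auto
      finally have "depth_potential r (q / real u) H \<le> K" .
      moreover have "time_decay L (Suc t) * vertex_decay N \<le> 1"
        by (intro mult_le_one time_decay_le_1 vertex_decay_le_1) (auto simp: L_def vertex_decay_def)
      moreover have "time_decay L (Suc t) * vertex_decay N \<ge> 0"
        using time_decay_pos[of L "Suc t"] by (simp add: vertex_decay_def)
      moreover have "depth_potential r (q / real u) H \<ge> 0" using q by (intro depth_potential_nonneg) simp
      ultimately have "time_decay L (Suc t) * vertex_decay N * depth_potential r (q / real u) H \<le> 1 * K"
        by (intro mult_mono) auto
      thus ?thesis by simp
    qed
    moreover have "card (verts H) < N \<or> card (verts H) = N" using True A(3) by linarith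
    ultimately show "stopped_potential r N K (q / real u) (time_decay L (Suc t)) H \<le>
        stopped_potential r N K (q / real u) (time_decay L t) G"
      using True by (auto simp: stopped_potential_def)
  qed
next
  case False
  have wf: "wf_multigraph G" "rooted r G" using G by (auto simp: admissible_def rooted_def)
  have V: "card (verts G) \<ge> 8" using False N by simp
  \<comment> \<open>The graph has outgrown \<open>G0\<close>, so a step has been made and at least
    \<open>l * t > 0\<close> edges are present.\<close>
  have t1: "t \<ge> 1" using False N G by (simp add: admissible_def)
  have E: "real l * real t \<le> real (size (edges G))"
    using G unfolding admissible_def by (metis of_nat_le_iff of_nat_mult)
  have lt: "real l * real t > 0" using x t1 by simp
  have x1: "x \<ge> 1" using x by simp
  define s where "s H = vertex_decay (card (verts H)) * depth_potential r (q / real u) H" for H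
  have s: "s H \<ge> 0" for H
    unfolding s_def using q by (intro mult_nonneg_nonneg depth_potential_nonneg) (auto simp: vertex_decay_def)
  have sp: "stopped_potential r N K (q / real u) c H = c * s H" if "card (verts H) \<ge> N" for H c
    using that by (simp add: stopped_potential_def s_def)
  have fin: "finite (set_pmf (cf_step p G x))" by (rule finite_set_cf_step[OF wf(1)])
  have "(\<integral>\<^sup>+H. ennreal (stopped_potential r N K (q / real u) (time_decay L (Suc t)) H) \<partial>measure_pmf (cf_step p G x))
      = (\<integral>\<^sup>+H. ennreal (time_decay L (Suc t) * s H) \<partial>measure_pmf (cf_step p G x))"
  proof (rule nn_integral_cong_AE, unfold AE_measure_pmf_iff, rule ballI)
    fix H assume "H \<in> set_pmf (cf_step p G x)"
    hence "card (verts H) \<ge> N" using admissible_cf_step(2)[OF G x(2,3) x1] False by fastforce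
    thus "ennreal (stopped_potential r N K (q / real u) (time_decay L (Suc t)) H) = ennreal (time_decay L (Suc t) * s H)"
      by (simp add: sp)
  qed
  also have "\<dots> = ennreal (measure_pmf.expectation (cf_step p G x) (\<lambda>H. time_decay L (Suc t) * s H))"
    using s time_decay_pos[of L "Suc t"]
    by (intro nn_integral_eq_integral integrable_measure_pmf_finite fin) (auto intro!: mult_nonneg_nonneg)
  also have "\<dots> \<le> ennreal (stopped_potential r N K (q / real u) (time_decay L t) G)"
  proof (rule ennreal_leI)
    have "measure_pmf.expectation (cf_step p G x) s \<le> s G * (1 + 7 / 2 * real u / real (size (edges G)))"
      unfolding s_def
      by (rule expectation_depth_potential_step[OF p q wf(2) V _ x1 x(3)]) (use E lt in auto)
    also have "\<dots> \<le> s G * (1 + L / real t)"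
    proof (intro mult_left_mono add_left_mono s)
      have "7 / 2 * real u / real (size (edges G)) \<le> 7 / 2 * real u / (real l * real t)"
        using E lt by (intro divide_left_mono mult_pos_pos[OF _ lt]) auto
      thus "7 / 2 * real u / real (size (edges G)) \<le> L / real t" by (simp add: L_def)
    qed
    finally have "time_decay L (Suc t) * measure_pmf.expectation (cf_step p G x) s \<le>
        time_decay L (Suc t) * (s G * (1 + L / real t))"
      by (rule mult_left_mono) (use time_decay_pos[of L "Suc t"] in simp)
    also have "\<dots> = (time_decay L (Suc t) * (1 + L / real t)) * s G" by simp
    also have "\<dots> \<le> time_decay L t * s G" by (rule mult_right_mono[OF time_decay_Suc[OF t1] s])
    also have "\<dots> = stopped_potential r N K (q / real u) (time_decay L t) G"
      using False by (simp add: sp)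
    finally show "measure_pmf.expectation (cf_step p G x) (\<lambda>H. time_decay L (Suc t) * s H)
        \<le> stopped_potential r N K (q / real u) (time_decay L t) G" by simp
  qed
  finally show ?thesis .
qed

text \<open>The type of graphs is uncountable; summing over the values of \<open>G t\<close> needs a countable set that
  contains them almost surely.\<close>

primrec reachable :: "(cf_op \<Rightarrow> real) \<Rightarrow> multigraph \<Rightarrow> nat \<Rightarrow> multigraph set" where
  "reachable p G0 0 = {G0}"
| "reachable p G0 (Suc t) = (\<Union>G\<in>reachable p G0 t. \<Union>x. set_pmf (cf_step p G x))"

lemma countable_reachable: "countable (reachable p G0 t)"
  by (induction t) auto

lemma rooted_if_connected:
  "connected_multigraph G \<Longrightarrow> r \<in> verts G \<Longrightarrow> rooted r G"
  by (auto simp: connected_multigraph_def rooted_def dest!: rtranclp_imp_relpowp)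

context cooper_frieze
begin

lemma sets_G: "{\<omega> \<in> space M. P (G t \<omega>)} \<in> sets M"
  using measurable_sets[OF measurable_G_M, of "Collect P" t]
  by (simp add: vimage_def Int_def conj_commute)

text \<open>One induction proves both claims, since the integral over the next step needs the
  countable almost sure support. The horizon \<open>n\<close> is fixed, because \<open>l\<close>,
  \<open>u\<close> and \<open>K\<close> belong to it. The initial value is \<open>K\<close> because
  \<open>card (verts G0) < N\<close>.\<close>

lemma nn_integral_stopped_potential_le:
  fixes q :: real and l u n N D :: nat
  defines "K \<equiv> (real N + 2 * real (size (edges G0) + n)) * exp (real (D + N))"
  defines "L \<equiv> 7 / 2 * (real u / real l)"
  assumes p: "\<And>i. p i \<ge> 0" "p Op_a + p Op_b + p Op_c + p Op_d + p Op_e + p Op_f = 1"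
    and q: "q = p Op_a + p Op_b" "q > 0"
    and bounds: "\<And>t \<omega>. 1 \<le> t \<Longrightarrow> t \<le> n \<Longrightarrow> \<omega> \<in> space M \<Longrightarrow> l \<le> X t \<omega> \<and> X t \<omega> \<le> u"
    and l: "1 \<le> l" and r: "r \<in> verts G0" and D: "\<And>v. v \<in> verts G0 \<Longrightarrow> depth r G0 v \<le> D"
    and N: "N = card (verts G0) + 8" and t: "t \<le> n"
  shows "AE \<omega> in M. G t \<omega> \<in> reachable p G0 t \<inter> Collect (admissible r G0 D l u t)"
    and "(\<integral>\<^sup>+\<omega>. ennreal (stopped_potential r N K (q / real u) (time_decay L t) (G t \<omega>)) \<partial>M) \<le> ennreal K"
proof -
  have "(AE \<omega> in M. G t \<omega> \<in> reachable p G0 t \<inter> Collect (admissible r G0 D l u t)) \<and>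
    (\<integral>\<^sup>+\<omega>. ennreal (stopped_potential r N K (q / real u) (time_decay L t) (G t \<omega>)) \<partial>M) \<le> ennreal K"
    using t
  proof (induction t)
    case 0
    have "admissible r G0 D l u 0 G0"
      using D rooted_if_connected[OF connected_G0 r] by (force simp: admissible_def)
    hence "AE \<omega> in M. G 0 \<omega> \<in> reachable p G0 0 \<inter> Collect (admissible r G0 D l u 0)"
      by (intro AE_I2) (simp add: G_0)
    moreover have "(\<integral>\<^sup>+\<omega>. ennreal (stopped_potential r N K (q / real u) (time_decay L 0) (G 0 \<omega>)) \<partial>M) =
        (\<integral>\<^sup>+\<omega>. ennreal K \<partial>M)"
      by (rule nn_integral_cong) (simp add: G_0 stopped_potential_def N)
    ultimately show ?case by (simp add: emeasure_space_1)
  next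
    case (Suc t)
    have AE: "AE \<omega> in M. G t \<omega> \<in> reachable p G0 t \<inter> Collect (admissible r G0 D l u t)" and
      IH: "(\<integral>\<^sup>+\<omega>. ennreal (stopped_potential r N K (q / real u) (time_decay L t) (G t \<omega>)) \<partial>M) \<le> ennreal K"
      using Suc by auto
    have X: "l \<le> X (Suc t) \<omega>" "X (Suc t) \<omega> \<le> u" if "\<omega> \<in> space M" for \<omega>
      using bounds[of "Suc t" \<omega>] that Suc.prems by auto
    have B: "countable (reachable p G0 (Suc t) \<inter> Collect (admissible r G0 D l u (Suc t)))"
      using countable_reachable[of p G0 "Suc t"] by (rule countable_subset[rotated]) blast
    have supp: "set_pmf (cf_step p H (X (Suc t) \<omega>)) \<subseteq>
        reachable p G0 (Suc t) \<inter> Collect (admissible r G0 D l u (Suc t))"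
      if H: "H \<in> reachable p G0 t \<inter> Collect (admissible r G0 D l u t)" and \<omega>: "\<omega> \<in> space M" for H \<omega>
    proof -
      have "X (Suc t) \<omega> \<ge> 1" using X(1)[OF \<omega>] l by simp
      thus ?thesis
        using admissible_cf_step(1)[of r G0 D l u t H "X (Suc t) \<omega>" _ p] H X[OF \<omega>] by auto
    qed
    note AE' = AE_G_Suc[OF AE B supp]
    have "(\<integral>\<^sup>+\<omega>. ennreal (stopped_potential r N K (q / real u) (time_decay L (Suc t)) (G (Suc t) \<omega>)) \<partial>M) =
      (\<integral>\<^sup>+\<omega>. (\<integral>\<^sup>+H. ennreal (stopped_potential r N K (q / real u) (time_decay L (Suc t)) H)
        \<partial>measure_pmf (cf_step p (G t \<omega>) (X (Suc t) \<omega>))) \<partial>M)"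
      by (rule nn_integral_G_Suc[OF AE B supp])
    also have "\<dots> \<le> (\<integral>\<^sup>+\<omega>. ennreal (stopped_potential r N K (q / real u) (time_decay L t) (G t \<omega>)) \<partial>M)"
    proof (rule nn_integral_mono_AE)
      show "AE \<omega> in M. (\<integral>\<^sup>+H. ennreal (stopped_potential r N K (q / real u) (time_decay L (Suc t)) H)
          \<partial>measure_pmf (cf_step p (G t \<omega>) (X (Suc t) \<omega>)))
        \<le> ennreal (stopped_potential r N K (q / real u) (time_decay L t) (G t \<omega>))"
        using AE AE_space
      proof eventually_elim
        case (elim \<omega>)
        hence A: "admissible r G0 D l u t (G t \<omega>)" by simp
        show ?case
          unfolding K_def L_def
          by (rule stopped_potential_step[OF p q A _ l X[OF elim(2)] N]) (use Suc.prems in simp)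
      qed
    qed
    also note IH
    finally show ?case using AE' by blast
  qed
  thus "AE \<omega> in M. G t \<omega> \<in> reachable p G0 t \<inter> Collect (admissible r G0 D l u t)"
    and "(\<integral>\<^sup>+\<omega>. ennreal (stopped_potential r N K (q / real u) (time_decay L t) (G t \<omega>)) \<partial>M) \<le> ennreal K"
    by blast+
qed

section \<open>Markov's inequality for the height\<close>

text \<open>The stopped potential has mean at most \<open>K\<close> and is at least \<open>a\<close>
  wherever some vertex is deeper than \<open>k\<close>, so this event has probability at most
  \<open>K / a\<close>. Elsewhere the diameter is almost surely at most twice the height
  bound.\<close>

lemma prob_depth_le:
  fixes q :: real and l u n N D :: nat and k :: real
  defines "K \<equiv> (real N + 2 * real (size (edges G0) + n)) * exp (real (D + N))"
  defines "L \<equiv> 7 / 2 * (real u / real l)"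
  assumes p: "\<And>i. p i \<ge> 0" "p Op_a + p Op_b + p Op_c + p Op_d + p Op_e + p Op_f = 1"
    and q: "q = p Op_a + p Op_b" "q > 0"
    and bounds: "\<And>t \<omega>. 1 \<le> t \<Longrightarrow> t \<le> n \<Longrightarrow> \<omega> \<in> space M \<Longrightarrow> l \<le> X t \<omega> \<and> X t \<omega> \<le> u"
    and l: "1 \<le> l" and r: "r \<in> verts G0" and D: "\<And>v. v \<in> verts G0 \<Longrightarrow> depth r G0 v \<le> D"
    and N: "N = card (verts G0) + 8" and n: "n \<ge> 1" and k: "real (D + N) \<le> k"
  shows "prob {\<omega> \<in> space M. ereal_of_enat (graph_diameter (G n \<omega>)) \<le> ereal (2 * k)} \<ge>
    1 - K * exp (L * (1 + ln (real n))) * real (card (verts G0) + n) ^ 7 * exp (- k)"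
proof -
  have adm: "AE \<omega> in M. G n \<omega> \<in> reachable p G0 n \<inter> Collect (admissible r G0 D l u n)"
    by (rule nn_integral_stopped_potential_le(1)[OF p q bounds l r D N order_refl])
  define bad where "bad = {\<omega> \<in> space M. \<exists>v\<in>verts (G n \<omega>). real (depth r (G n \<omega>) v) > k}"
  have bad: "bad \<in> sets M" unfolding bad_def by (rule sets_G)
  \<comment> \<open>A lower bound, factor by factor, for the time decay, the vertex decay and the
    weight of one deep vertex.\<close>
  define a where "a = exp (- L * (1 + ln (real n))) * (1 / real (card (verts G0) + n) ^ 7) * exp k"
  have L: "L \<ge> 0" by (simp add: L_def)
  have a: "a > 0" unfolding a_def using n by (intro mult_pos_pos) auto
  have K: "K \<ge> 0" by (simp add: K_def)
  have "AE \<omega> in M. ennreal a * indicator bad \<omega> \<le>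
      ennreal (stopped_potential r N K (q / real u) (time_decay L n) (G n \<omega>))"
    using adm AE_space
  proof eventually_elim
    case (elim \<omega>)
    hence A: "rooted r (G n \<omega>)" "card (verts (G n \<omega>)) \<le> card (verts G0) + n"
      "\<And>v. v \<in> verts (G n \<omega>) \<Longrightarrow> depth r (G n \<omega>) v \<le> D + card (verts (G n \<omega>))"
      by (auto simp: admissible_def)
    show ?case
    proof (cases "\<omega> \<in> bad")
      case True
      then obtain v where v: "v \<in> verts (G n \<omega>)" "real (depth r (G n \<omega>) v) > k"
        by (auto simp: bad_def)
      \<comment> \<open>A depth above \<open>D + N\<close> forces at least \<open>N\<close>
        vertices, so the stopped potential is the genuine one here and not \<open>K\<close>.\<close>
      have big: "card (verts (G n \<omega>)) \<ge> N" using A(3)[OF v(1)] v(2) k by linarith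
      have fin: "finite (verts (G n \<omega>))" using A(1) by (simp add: rooted_def wf_multigraph_def)
      have "exp k \<le> exp (real (depth r (G n \<omega>) v))" using v by simp
      also have "\<dots> \<le> vertex_weight r (G n \<omega>)"
        unfolding vertex_weight_def by (rule member_le_sum[OF v(1)]) (use fin in auto)
      also have "\<dots> \<le> depth_potential r (q / real u) (G n \<omega>)"
        using q degree_weight_nonneg by (simp add: depth_potential_def)
      finally have 1: "exp k \<le> depth_potential r (q / real u) (G n \<omega>)" .
      have "1 / real (card (verts G0) + n) ^ 7 \<le> 1 / real (card (verts (G n \<omega>))) ^ 7"
        using A(2) big N by (intro divide_left_mono power_mono mult_pos_pos) auto
      also have "\<dots> \<le> vertex_decay (card (verts (G n \<omega>)))"
        by (rule vertex_decay_ge) (use big N in simp)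
      finally have 2: "1 / real (card (verts G0) + n) ^ 7 \<le> vertex_decay (card (verts (G n \<omega>)))" .
      have 3: "exp (- L * (1 + ln (real n))) \<le> time_decay L n"
        unfolding time_decay_def exp_le_cancel_iff
        by (rule mult_left_mono_neg[OF sum_inverse_le_ln[OF n]]) (use L in simp)
      have "a \<le> time_decay L n * vertex_decay (card (verts (G n \<omega>))) * depth_potential r (q / real u) (G n \<omega>)"
        unfolding a_def using 1 2 3 time_decay_pos[of L n] by (intro mult_mono) (auto simp: vertex_decay_def)
      thus ?thesis using True big by (simp add: stopped_potential_def ennreal_leI)
    qed simp
  qed
  hence "(\<integral>\<^sup>+\<omega>. ennreal a * indicator bad \<omega> \<partial>M) \<le>
      (\<integral>\<^sup>+\<omega>. ennreal (stopped_potential r N K (q / real u) (time_decay L n) (G n \<omega>)) \<partial>M)"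
    by (rule nn_integral_mono_AE)
  also have "\<dots> \<le> ennreal K"
    unfolding K_def L_def
    by (rule nn_integral_stopped_potential_le(2)[OF p q bounds l r D N order_refl])
  finally have "ennreal a * emeasure M bad \<le> ennreal K"
    using bad by (simp add: nn_integral_cmult_indicator)
  hence "ennreal (a * prob bad) \<le> ennreal K"
    using a by (simp add: emeasure_eq_measure ennreal_mult)
  hence "a * prob bad \<le> K" using K by (simp add: ennreal_le_iff)
  hence "prob bad \<le> K / a" using a by (simp add: field_simps)
  also have "K / a = K * exp (L * (1 + ln (real n))) * real (card (verts G0) + n) ^ 7 * exp (- k)"
  proof -
    have "exp (- L * (1 + ln (real n))) = inverse (exp (L * (1 + ln (real n))))"
      by (simp flip: exp_minus)
    thus ?thesis by (simp only: a_def exp_minus) (simp add: divide_inverse)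
  qed
  finally have "1 - K * exp (L * (1 + ln (real n))) * real (card (verts G0) + n) ^ 7 * exp (- k) \<le>
      1 - prob bad" by simp
  also have "1 - prob bad = prob (space M - bad)" using bad by (simp add: prob_compl)
  also have "\<dots> \<le> prob {\<omega> \<in> space M. ereal_of_enat (graph_diameter (G n \<omega>)) \<le> ereal (2 * k)}"
  proof (rule finite_measure_mono_AE)
    show "AE \<omega> in M. \<omega> \<in> space M - bad \<longrightarrow>
        \<omega> \<in> {\<omega> \<in> space M. ereal_of_enat (graph_diameter (G n \<omega>)) \<le> ereal (2 * k)}"
      using adm
    proof eventually_elim
      case (elim \<omega>)
      hence A: "rooted r (G n \<omega>)" by (simp add: admissible_def)
      show ?case
      proof
        assume "\<omega> \<in> space M - bad"
        hence \<omega>: "\<omega> \<in> space M" "\<And>v. v \<in> verts (G n \<omega>) \<Longrightarrow> real (depth r (G n \<omega>) v) \<le> k"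
          by (auto simp: bad_def not_less)
        show "\<omega> \<in> {\<omega> \<in> space M. ereal_of_enat (graph_diameter (G n \<omega>)) \<le> ereal (2 * k)}"
          using graph_diameter_le[OF A \<omega>(2)] \<omega>(1) by simp
      qed
    qed
  qed (rule sets_G)
  finally show ?thesis .
qed

end

section \<open>Choice of constants and the limit\<close>

theorem theorem5p1:
  fixes M :: "'w measure" and F :: "nat \<Rightarrow> 'w measure"
    and p :: "cf_op \<Rightarrow> real" and q :: real
    and G0 :: multigraph
    and X :: "nat \<Rightarrow> 'w \<Rightarrow> nat" and G :: "nat \<Rightarrow> 'w \<Rightarrow> multigraph"
    and l u :: "nat \<Rightarrow> nat"
  assumes p_nonneg: "\<And>i. p i \<ge> 0"
    and p_sum: "p Op_a + p Op_b + p Op_c + p Op_d + p Op_e + p Op_f = 1"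
    and q_def: "q = p Op_a + p Op_b"
    and q_pos: "p Op_a + p Op_b > 0"
    and model: "cooper_frieze M F p G0 X G"
    and l_pos: "\<And>n. n \<ge> 1 \<Longrightarrow> l n \<ge> 1"
    and u_pos: "\<And>n. n \<ge> 1 \<Longrightarrow> u n \<ge> 1"
    and bounds: "\<And>n t \<omega>. 1 \<le> t \<Longrightarrow> t \<le> n \<Longrightarrow> \<omega> \<in> space M \<Longrightarrow> l n \<le> X t \<omega> \<and> X t \<omega> \<le> u n"
  shows "\<exists>C::real.
    (\<lambda>n. measure M {\<omega> \<in> space M.
        ereal_of_enat (graph_diameter (G n \<omega>))
          \<le> ereal (4 * (real (u n) / real (l n) + 11 / q) * exp 1 * ln (real n)
                   + 8 * exp 1 * (real (u n) / real (l n)) + C)})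
      \<longlonglongrightarrow> 1"
proof -
  interpret cooper_frieze M F p G0 X G by (rule model)
  obtain r where r: "r \<in> verts G0"
    using connected_G0 by (auto simp: connected_multigraph_def wf_multigraph_def)
  have finV: "finite (verts G0)"
    using connected_G0 by (simp add: connected_multigraph_def wf_multigraph_def)
  define D where "D = Max (depth r G0 ` verts G0)"
  have D: "depth r G0 v \<le> D" if "v \<in> verts G0" for v
    using that finV by (simp add: D_def)
  define N where "N = card (verts G0) + 8"
  \<comment> \<open>Depends on \<open>G0\<close> only, hence not on \<open>n\<close>.\<close>
  define C where "C = 2 * real (D + N)"
  define P where "P n = measure M {\<omega> \<in> space M.
        ereal_of_enat (graph_diameter (G n \<omega>))
          \<le> ereal (4 * (real (u n) / real (l n) + 11 / q) * exp 1 * ln (real n)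
                   + 8 * exp 1 * (real (u n) / real (l n)) + C)}" for n
  have q: "q > 0" using q_def q_pos by simp
  have q1: "q \<le> 1"
    using p_nonneg[of Op_c] p_nonneg[of Op_d] p_nonneg[of Op_e] p_nonneg[of Op_f] p_sum q_def by linarith
  have e2: "exp (1::real) \<ge> 2" using exp_ge_add_one_self[of "1::real"] by simp
  \<comment> \<open>Large enough that each of the eight polynomial factors of the failure
    probability is at most \<open>c * n\<close>.\<close>
  define c where "c = real N + 2 * real (size (edges G0)) + 2"
  have lower: "1 - c ^ 8 / real n \<le> P n" if n: "n \<ge> 1" for n
  proof -
    define \<rho> where "\<rho> = real (u n) / real (l n)"
    \<comment> \<open>Half of the claimed bound, since the diameter is at most
      \<open>2 * k\<close>.\<close>
    define k where "k = 2 * (\<rho> + 11 / q) * exp 1 * ln (real n) + 4 * exp 1 * \<rho> + real (D + N)"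
    have ln: "ln (real n) \<ge> 0" using n by simp
    have \<rho>: "\<rho> \<ge> 0" by (simp add: \<rho>_def)
    have "11 * 2 \<le> 11 / q * exp 1"
      using q q1 e2 by (intro mult_mono) (auto simp: field_simps)
    hence "22 * ln (real n) \<le> 11 / q * exp 1 * ln (real n)"
      by (intro mult_right_mono ln) simp
    moreover have "\<rho> * ln (real n) * 2 \<le> \<rho> * ln (real n) * exp 1" "\<rho> * 2 \<le> \<rho> * exp 1"
      using \<rho> ln e2 by (auto intro!: mult_left_mono)
    moreover have "k = 2 * (\<rho> * ln (real n) * exp 1) + 2 * (11 / q * exp 1 * ln (real n))
        + 4 * (\<rho> * exp 1) + real (D + N)"
      by (simp add: k_def algebra_simps)
    moreover have "\<rho> * ln (real n) \<ge> 0" using \<rho> ln by simp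
    \<comment> \<open>With exp 1 \<ge> 2 the two terms in \<rho> are at least 4 \<rho> ln n and 8
      \<rho>, both above 7/2; with q \<le> 1 the remaining one is at least 44 ln n.\<close>
    ultimately have kk: "7 / 2 * (\<rho> * (1 + ln (real n))) + 44 * ln (real n) + real (D + N) \<le> k"
      using \<rho> unfolding distrib_left mult_1_right by linarith
    have kN: "real (D + N) \<le> k" using kk \<rho> ln mult_nonneg_nonneg[of \<rho> "1 + ln (real n)"] by linarith
    have c: "c \<ge> 1" by (simp add: c_def)
    have "(real N + 2 * real (size (edges G0) + n)) * exp (real (D + N)) *
        exp (7 / 2 * (real (u n) / real (l n)) * (1 + ln (real n))) * real (card (verts G0) + n) ^ 7 * exp (- k)
      = ((real N + 2 * real (size (edges G0) + n)) * real (card (verts G0) + n) ^ 7) *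
         exp (real (D + N) + 7 / 2 * (\<rho> * (1 + ln (real n))) - k)"
      by (simp add: \<rho>_def exp_add exp_diff exp_minus field_simps)
    \<comment> \<open>Of the 44 ln n only 9 are kept: 8 against the polynomial factors and one to
      leave a failure probability of order 1/n.\<close>
    also have "\<dots> \<le> ((c * real n) * (c * real n) ^ 7) * exp (- (9 * ln (real n)))"
    proof (intro mult_mono power_mono)
      have m: "y \<le> y * real n" if "y \<ge> 0" for y :: real
        using that n by (simp add: mult_le_cancel_left1)
      show "real N + 2 * real (size (edges G0) + n) \<le> c * real n"
        using m[of "real N + 2 * real (size (edges G0))"] by (simp add: c_def algebra_simps)
      show "real (card (verts G0) + n) \<le> c * real n"
        using m[of "real (card (verts G0)) + 7 + 2 * real (size (edges G0))"]
        by (simp add: c_def N_def algebra_simps)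
      show "exp (real (D + N) + 7 / 2 * (\<rho> * (1 + ln (real n))) - k) \<le> exp (- (9 * ln (real n)))"
        using kk ln by simp
    qed (use c in auto)
    also have "\<dots> = c ^ 8 / real n"
    proof -
      have "exp (9 * ln (real n)) = real n ^ 9"
        using n exp_of_nat_mult[of 9 "ln (real n)"] by simp
      thus ?thesis using n by (simp add: exp_minus field_simps eval_nat_numeral)
    qed
    finally have le: "1 - c ^ 8 / real n \<le> 1 - (real N + 2 * real (size (edges G0) + n)) * exp (real (D + N)) *
        exp (7 / 2 * (real (u n) / real (l n)) * (1 + ln (real n))) * real (card (verts G0) + n) ^ 7 * exp (- k)"
      by simp
    also have "\<dots> \<le> prob {\<omega> \<in> space M. ereal_of_enat (graph_diameter (G n \<omega>)) \<le> ereal (2 * k)}"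
      by (rule prob_depth_le[OF p_nonneg p_sum q_def q bounds l_pos[OF n] r D N_def n kN])
    also have "2 * k = 4 * (real (u n) / real (l n) + 11 / q) * exp 1 * ln (real n)
                   + 8 * exp 1 * (real (u n) / real (l n)) + C"
      by (simp add: k_def \<rho>_def C_def algebra_simps)
    finally show ?thesis unfolding P_def .
  qed
  have "P \<longlonglongrightarrow> 1"
  proof (rule tendsto_sandwich)
    show "\<forall>\<^sub>F n in sequentially. 1 - c ^ 8 / real n \<le> P n"
      using lower by (intro eventually_sequentiallyI[of 1])
    show "\<forall>\<^sub>F n in sequentially. P n \<le> 1" unfolding P_def by simp
    show "(\<lambda>n. 1 - c ^ 8 / real n) \<longlonglongrightarrow> 1"
      using tendsto_diff[OF tendsto_const[of "1::real"] lim_const_over_n[of "c ^ 8"]] by simp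
  qed simp
  thus ?thesis unfolding P_def by blast
qed

end
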